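(* Let $k,d,D\ge 1$ and $0\le m\le k$ be integers. Let $f:\mathbb{R}^d\to\mathbb{R}^D$ be a $C^k$ function and let $(X,Y)$ be a pair of random variables with values in $\mathbb{R}^d\times\mathbb{R}^D$ such that: (i) the distribution of $X$ is absolutely continuous, and its density is bounded away from zero and from infinity on an open neighborhood $U$ of the origin of $\mathbb{R}^d$; (ii) $f(x)=\mathbb{E}(Y\mid X=x)$; (iii) there is a constant $c$ such that $\|\operatorname{cov}(Y\mid X=x)\|_{op}\le\sqrt{c/D}$ for all $x$. Let $L=\sum_{|\alpha|\le m}c_\alpha\partial^\alpha$ be a differential operator with constant coefficients $c_\alpha\in\mathbb{R}$, and let $T(f)=L[f](0)\in\mathbb{R}^D$. Let $(\epsilon_n)_{n\ge1}$ be a sequence of positive numbers such that $0<\lim_{n\to\infty}n^{\frac{1}{2k+d}}\epsilon_n<\infty$. Given a sample $\{(x_i,y_i)\}_{i=1}^n$ drawn i.i.d. from $(X,Y)$, let $\pi^*$ be the local polynomial regressor of degree at most $k-1$ with bandwidth $\epsilon_n$ (defined in the context), and let $\widehat T_n=L[\pi^*](0)\in\mathbb{R}^D$. Then for every $\varepsilon>0$ there are $C$ and $N$ large enough such that for every $n>N$, $$\Pr\left(\|\widehat T_n-T(f)\|>\frac{C}{n^r}\right)\le\varepsilon,\qquad r=\frac{k-m}{2k+d}.$$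
   Context: $\|\cdot\|$ is the Euclidean norm and $\|\cdot\|_{op}$ the Euclidean operator norm of matrices. For a multi-index $\alpha=(\alpha_1,\dots,\alpha_d)$ of non-negative integers, $|\alpha|=\sum_j\alpha_j$ and $\partial^\alpha=\partial_{x_1}^{\alpha_1}\cdots\partial_{x_d}^{\alpha_d}$; $L$ acts on $\mathbb{R}^D$-valued functions coordinatewise. The noise is $Z=f(X)-Y$, so that $\operatorname{cov}(Z\mid X=x)=\operatorname{cov}(Y\mid X=x)$ (a $D\times D$ matrix). Let $\Pi_{k-1}^{d\mapsto D}$ be the space of maps $\mathbb{R}^d\to\mathbb{R}^D$ each of whose coordinates is a polynomial of total degree at most $k-1$. The local polynomial regressor with bandwidth $\epsilon_n$ is a minimizer $$\pi^*=\operatorname*{arg\,min}_{\pi\in\Pi_{k-1}^{d\mapsto D}}\frac{1}{|I_n|}\sum_{i\in I_n}\|y_i-\pi(x_i)\|^2,\qquad I_n=\{i : 1\le i\le n,\ \|x_i\|\le\epsilon_n\},$$ where $|I_n|$ is the number of elements of $I_n$. *)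

theory Defs
  imports "HOL-Probability.Probability"
begin

definition multi_indices :: "nat \<Rightarrow> ('d::finite \<Rightarrow> nat) set" where
  "multi_indices r = {\<alpha>. (\<Sum>i\<in>UNIV. \<alpha> i) \<le> r}"

definition partial_deriv ::
    "'d::finite \<Rightarrow> (real^'d \<Rightarrow> real) \<Rightarrow> real^'d \<Rightarrow> real" where
  "partial_deriv i g x = deriv (\<lambda>t. g (x + t *\<^sub>R axis i 1)) 0"

text \<open>The coordinates are indexed by a finite linearly ordered type, so that the order of
  composition (last coordinate differentiated first) is determined.\<close>

definition multi_partial ::
    "('d::{finite,linorder} \<Rightarrow> nat) \<Rightarrow> (real^'d::_ \<Rightarrow> real) \<Rightarrow> real^'d::_ \<Rightarrow> real" where
  "multi_partial \<alpha> g = foldr (\<lambda>i. partial_deriv i ^^ \<alpha> i) (sorted_list_of_set UNIV) g"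

text \<open>All iterated partial derivatives of order at most \<open>k\<close> exist and are continuous.\<close>

primrec C_scalar :: "nat \<Rightarrow> (real^'d::finite \<Rightarrow> real) \<Rightarrow> bool" where
  "C_scalar 0 g \<longleftrightarrow> continuous_on UNIV g"
| "C_scalar (Suc k) g \<longleftrightarrow> continuous_on UNIV g \<and>
     (\<forall>i. (\<forall>x. (\<lambda>t::real. g (x + t *\<^sub>R axis i 1)) field_differentiable (at 0)) \<and>
          C_scalar k (partial_deriv i g))"

definition C_map :: "nat \<Rightarrow> (real^'d::finite \<Rightarrow> real^'D::finite) \<Rightarrow> bool" where
  "C_map k f \<longleftrightarrow> (\<forall>j. C_scalar k (\<lambda>x. f x $ j))"

definition diff_op ::
    "nat \<Rightarrow> (('d::{finite,linorder} \<Rightarrow> nat) \<Rightarrow> real) \<Rightarrow>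
     (real^'d::_ \<Rightarrow> real^'D::finite) \<Rightarrow> real^'d::_ \<Rightarrow> real^'D" where
  "diff_op m a f x =
     (\<chi> j. \<Sum>\<alpha>\<in>multi_indices m. a \<alpha> * multi_partial \<alpha> (\<lambda>x. f x $ j) x)"

definition poly_maps :: "nat \<Rightarrow> (real^'d::finite \<Rightarrow> real^'D::finite) set" where
  "poly_maps r = {q. \<forall>j. \<exists>b :: ('d \<Rightarrow> nat) \<Rightarrow> real. \<forall>x.
     q x $ j = (\<Sum>\<alpha>\<in>multi_indices r. b \<alpha> * (\<Prod>i\<in>UNIV. (x $ i) ^ \<alpha> i))}"

definition local_indices :: "nat \<Rightarrow> real \<Rightarrow> (nat \<Rightarrow> real^'d::finite) \<Rightarrow> nat set" where
  "local_indices n h x = {i\<in>{1..n}. norm (x i) \<le> h}"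

definition local_loss ::
    "nat \<Rightarrow> real \<Rightarrow> (nat \<Rightarrow> real^'d::finite) \<Rightarrow> (nat \<Rightarrow> real^'D::finite) \<Rightarrow>
     (real^'d \<Rightarrow> real^'D) \<Rightarrow> real" where
  "local_loss n h x y q =
     1 / real (card (local_indices n h x)) *
       (\<Sum>i\<in>local_indices n h x. (norm (y i - q (x i)))\<^sup>2)"

text \<open>The minimizer need not be unique. If no sample point lies in the ball, the loss is
  identically zero and every element of \<open>poly_maps r\<close> is a minimizer.\<close>

definition local_poly_regressor ::
    "nat \<Rightarrow> nat \<Rightarrow> real \<Rightarrow> (nat \<Rightarrow> real^'d::finite) \<Rightarrow> (nat \<Rightarrow> real^'D::finite) \<Rightarrow>
     (real^'d \<Rightarrow> real^'D) \<Rightarrow> bool" where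
  "local_poly_regressor r n h x y q \<longleftrightarrow>
     is_arg_min (local_loss n h x y) (\<lambda>q. q \<in> poly_maps r) q"

abbreviation sigma_gen :: "'w measure \<Rightarrow> ('w \<Rightarrow> real^'d::finite) \<Rightarrow> 'w measure" where
  "sigma_gen M X \<equiv> vimage_algebra (space M) X borel"

definition cond_mean ::
    "'w measure \<Rightarrow> ('w \<Rightarrow> real^'d::finite) \<Rightarrow> ('w \<Rightarrow> real^'D::finite) \<Rightarrow> 'w \<Rightarrow> real^'D" where
  "cond_mean M X Y w = (\<chi> j. real_cond_exp M (sigma_gen M X) (\<lambda>v. Y v $ j) w)"

definition cond_cov ::
    "'w measure \<Rightarrow> ('w \<Rightarrow> real^'d::finite) \<Rightarrow> ('w \<Rightarrow> real^'D::finite) \<Rightarrow> 'w \<Rightarrow> real^'D^'D" where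
  "cond_cov M X Y w =
     (\<chi> i j. real_cond_exp M (sigma_gen M X)
        (\<lambda>v. (Y v $ i - cond_mean M X Y v $ i) * (Y v $ j - cond_mean M X Y v $ j)) w)"

text \<open>\<open>real_cond_exp\<close> is the difference of the conditional expectations of the positive and
  negative parts, with infinite values silently replaced by zero. The following condition, that
  \<open>\<parallel>Y\<parallel>\<^sup>2\<close> has almost surely finite conditional expectation given \<open>X\<close>, is what makes
  \<open>cond_mean\<close> and \<open>cond_cov\<close> meaningful; \<open>Y\<close> itself need not be integrable.\<close>

definition cond_second_moment_finite ::
    "'w measure \<Rightarrow> ('w \<Rightarrow> real^'d::finite) \<Rightarrow> ('w \<Rightarrow> real^'D::finite) \<Rightarrow> bool" where
  "cond_second_moment_finite M X Y \<longleftrightarrow>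
     (AE w in M. nn_cond_exp M (sigma_gen M X) (\<lambda>v. ennreal ((norm (Y v))\<^sup>2)) w < \<infinity>)"

definition iid_sample ::
    "'w measure \<Rightarrow> ('w \<Rightarrow> real^'d::finite) \<Rightarrow> ('w \<Rightarrow> real^'D::finite) \<Rightarrow> nat \<Rightarrow>
     's measure \<Rightarrow> (nat \<Rightarrow> 's \<Rightarrow> real^'d) \<Rightarrow> (nat \<Rightarrow> 's \<Rightarrow> real^'D) \<Rightarrow> bool" where
  "iid_sample M X Y n S x y \<longleftrightarrow>
     prob_space S \<and>
     prob_space.indep_vars S (\<lambda>_. borel) (\<lambda>i s. (x i s, y i s)) {1..n} \<and>
     (\<forall>i\<in>{1..n}. distr S borel (\<lambda>s. (x i s, y i s)) = distr M borel (\<lambda>w. (X w, Y w)))"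

end

theory Submission
  imports Defs
begin

text \<open>
  Rescale by the bandwidth \<open>h\<close> and compare the regressor, one coordinate at a time, with the Taylor
  polynomial \<open>P\<close> of \<open>f\<close> of degree \<open>k - 1\<close> at the origin. Let \<open>\<theta>\<close> be the coefficients of the difference
  \<open>\<pi>\<^sup>* - P\<close> in the variable \<open>x/h\<close>. As \<open>\<pi>\<^sup>*\<close> minimizes the sum of squares, the sum of \<open>(\<pi>\<^sup>* - P)\<^sup>2\<close> over the
  sample points in the ball is at most twice the correlation of \<open>\<pi>\<^sup>* - P\<close> with the residuals \<open>y - P(x)\<close>.

  The left-hand side dominates \<open>n h\<^sup>d (\<Sum>\<^sub>\<alpha> |\<theta> \<alpha>|)\<^sup>2\<close> up to a constant. This lower
  bound for a random Gram matrix comes from interpolation: the coefficients of a polynomial are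
  controlled by its values at any choice of one point in each of finitely many small cells
  (\<open>grid_bounds_coefficients\<close>), so it suffices that every cell contains at least \<open>const * n h\<^sup>d\<close> sample
  points (\<open>occupied_cells_control_least_squares\<close>). The number of points in a cell has a mean of this
  order because the density is bounded below, and Chebyshev's inequality applies.

  On the right-hand side, the residuals split into the bias \<open>f(x) - P(x)\<close>, of size \<open>O(h\<^sup>k)\<close> at each of the
  \<open>O(n h\<^sup>d)\<close> points, and the noise, whose sum against a monomial is centered with variance \<open>O(n h\<^sup>d)\<close>
  (\<open>truncated_noise_moments\<close>). Dividing by \<open>n h\<^sup>d\<close> gives
  \<open>\<Sum>\<^sub>\<alpha> |\<theta> \<alpha>| = O(h\<^sup>k + 1 / sqrt (n h\<^sup>d))\<close> outside of an event of small probability, and both terms are of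
  order \<open>n powr (- k / (2 k + d))\<close> for the given bandwidth (\<open>regressor_coefficient_bound\<close>). Undoing the rescaling
  in a derivative of order at most \<open>m\<close> costs a factor \<open>1 / h\<^sup>m\<close> (\<open>diff_op_coordinate_error\<close>).
\<close>

section \<open>Taylor polynomials\<close>

definition multi_power :: "real^'d::finite \<Rightarrow> ('d \<Rightarrow> nat) \<Rightarrow> real" where
  "multi_power x \<alpha> = (\<Prod>i\<in>UNIV. (x $ i) ^ \<alpha> i)"

definition multi_fact :: "('d::finite \<Rightarrow> nat) \<Rightarrow> real" where
  "multi_fact \<alpha> = (\<Prod>i\<in>UNIV. fact (\<alpha> i))"

lemma multi_fact_pos: "multi_fact \<alpha> > 0"
  by (simp add: multi_fact_def prod_pos)

lemma finite_multi_indices: "finite (multi_indices r :: ('d::finite \<Rightarrow> nat) set)"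
proof (rule finite_subset)
  show "multi_indices r \<subseteq> (PiE UNIV (\<lambda>_. {..r}) :: ('d \<Rightarrow> nat) set)"
  proof
    fix \<alpha> :: "'d \<Rightarrow> nat" assume "\<alpha> \<in> multi_indices r"
    then have "\<alpha> i \<le> r" for i
      using member_le_sum[of i UNIV \<alpha>] by (auto simp: multi_indices_def)
    then show "\<alpha> \<in> PiE UNIV (\<lambda>_. {..r})" by auto
  qed
qed (auto intro: finite_PiE)

lemma C_scalar_continuous: "C_scalar k g \<Longrightarrow> continuous_on UNIV g"
  by (cases k) auto

lemma C_scalar_iterate_partial_deriv:
  "C_scalar k g \<Longrightarrow> j \<le> k \<Longrightarrow> C_scalar (k - j) ((partial_deriv i ^^ j) g)"
proof (induction j)
  case (Suc j)
  then have "C_scalar (Suc (k - Suc j)) ((partial_deriv i ^^ j) g)"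
    by (simp add: Suc_diff_Suc)
  then show ?case by simp
qed auto

lemma partial_deriv_has_derivative:
  assumes "C_scalar (Suc k) g"
  shows "((\<lambda>t. g (x + t *\<^sub>R axis i 1)) has_real_derivative
           partial_deriv i g (x + t *\<^sub>R axis i 1)) (at t)"
proof -
  have "(\<lambda>s::real. g ((x + t *\<^sub>R axis i 1) + s *\<^sub>R axis i 1)) field_differentiable (at 0)"
    using assms by simp
  then have "((\<lambda>s::real. g ((x + t *\<^sub>R axis i 1) + s *\<^sub>R axis i 1)) has_real_derivative
           partial_deriv i g (x + t *\<^sub>R axis i 1)) (at 0)"
    unfolding partial_deriv_def by (simp add: field_differentiable_derivI)
  then have "((\<lambda>s::real. g (x + (s + t) *\<^sub>R axis i 1)) has_real_derivative
           partial_deriv i g (x + t *\<^sub>R axis i 1)) (at 0)"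
    by (simp add: scaleR_add_left algebra_simps)
  then show ?thesis
    using DERIV_shift[of "\<lambda>s. g (x + s *\<^sub>R axis i 1)" _ 0 t] by (simp add: add.commute)
qed

text \<open>Taylor's formula with the mixed partials taken in one prescribed order. Expanding in the last
  coordinate of \<open>L\<close> first, with the one-variable formula, and then each coefficient
  \<open>\<partial>\<^sub>i\<^sup>a g\<close>, which is of class \<open>C\<^sup>k\<^sup>-\<^sup>a\<close>, in the remaining coordinates, differentiates in exactly the
  order of the \<open>foldr\<close>.\<close>

lemma Taylor_along_coordinates:
  fixes g :: "real^'d::finite \<Rightarrow> real"
  assumes "distinct L" "C_scalar k g"
  shows "\<exists>K\<ge>0. \<forall>x. norm x \<le> 1 \<longrightarrow> (\<forall>i. i \<notin> set L \<longrightarrow> x $ i = 0) \<longrightarrow>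
    \<bar>g x - (\<Sum>\<alpha>\<in>{\<alpha>. (\<forall>i. i \<notin> set L \<longrightarrow> \<alpha> i = 0) \<and> (\<Sum>i\<in>UNIV. \<alpha> i) < k}.
       foldr (\<lambda>i. partial_deriv i ^^ \<alpha> i) L g 0 / multi_fact \<alpha> * multi_power x \<alpha>)\<bar> \<le> K * norm x ^ k"
  using assms
proof (induction L arbitrary: k g rule: rev_induct)
  case Nil
  show ?case
  proof (intro exI[of _ "\<bar>g 0\<bar>"] conjI allI impI)
    fix x :: "real^'d" assume "\<forall>i. i \<notin> set [] \<longrightarrow> x $ i = 0"
    then have x: "x = 0" by (simp add: vec_eq_iff)
    show "\<bar>g x - (\<Sum>\<alpha>\<in>{\<alpha>. (\<forall>i. i \<notin> set [] \<longrightarrow> \<alpha> i = 0) \<and> (\<Sum>i\<in>UNIV. \<alpha> i) < k}.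
       foldr (\<lambda>i. partial_deriv i ^^ \<alpha> i) [] g 0 / multi_fact \<alpha> * multi_power x \<alpha>)\<bar> \<le> \<bar>g 0\<bar> * norm x ^ k"
    proof (cases "k = 0")
      case False
      then have "{\<alpha>::'d\<Rightarrow>nat. (\<forall>i. i \<notin> set [] \<longrightarrow> \<alpha> i = 0) \<and> (\<Sum>i\<in>UNIV. \<alpha> i) < k} = {\<lambda>_. 0}"
        by (auto simp: fun_eq_iff)
      then show ?thesis by (simp add: x multi_fact_def multi_power_def)
    qed (simp add: x)
  qed auto
next
  case (snoc i L)
  define J where "J = (\<lambda>k::nat. {\<alpha>::'d\<Rightarrow>nat. (\<forall>l. l \<notin> set L \<longrightarrow> \<alpha> l = 0) \<and> (\<Sum>l\<in>UNIV. \<alpha> l) < k})"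
  define J' where "J' = {\<alpha>::'d\<Rightarrow>nat. (\<forall>l. l \<notin> set (L @ [i]) \<longrightarrow> \<alpha> l = 0) \<and> (\<Sum>l\<in>UNIV. \<alpha> l) < k}"
  define D where "D = (\<lambda>a. (partial_deriv i ^^ a) g)"
  define P where "P = (\<lambda>a x. \<Sum>\<alpha>\<in>J (k - a).
       foldr (\<lambda>i. partial_deriv i ^^ \<alpha> i) L (D a) 0 / multi_fact \<alpha> * multi_power x \<alpha>)"
  have iL: "i \<notin> set L" and dL: "distinct L" using snoc.prems by auto
  have CD: "C_scalar (k - a) (D a)" if "a \<le> k" for a
    unfolding D_def using C_scalar_iterate_partial_deriv[OF snoc.prems(2) that] .
  have "\<exists>K. \<forall>a\<le>k. K a \<ge> 0 \<and> (\<forall>x. norm x \<le> 1 \<longrightarrow> (\<forall>i. i \<notin> set L \<longrightarrow> x $ i = 0) \<longrightarrow>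
          \<bar>D a x - P a x\<bar> \<le> K a * norm x ^ (k - a))"
    using snoc.IH[OF dL CD] unfolding P_def J_def by (intro choice) blast
  then obtain K where K0: "\<And>a. a \<le> k \<Longrightarrow> K a \<ge> 0"
    and K: "\<And>a x. a \<le> k \<Longrightarrow> norm x \<le> 1 \<Longrightarrow> (\<forall>i. i \<notin> set L \<longrightarrow> x $ i = 0) \<Longrightarrow>
          \<bar>D a x - P a x\<bar> \<le> K a * norm x ^ (k - a)"
    by blast
  have "compact (D k ` cball 0 1)"
    using C_scalar_continuous[OF CD[of k]]
    by (intro compact_continuous_image) (auto intro: continuous_on_subset)
  then obtain B where B: "\<And>x. norm x \<le> 1 \<Longrightarrow> \<bar>D k x\<bar> \<le> B"
    using compact_imp_bounded bounded_iff by (metis imageI mem_cball_0 real_norm_def)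
  have B0: "B \<ge> 0" using B[of 0] by simp
  show ?case
  proof (intro exI[of _ "B + (\<Sum>a<k. K a)"] conjI allI impI)
    show "B + (\<Sum>a<k. K a) \<ge> 0" using B0 K0 by (auto intro!: add_nonneg_nonneg sum_nonneg)
    fix x :: "real^'d" assume x1: "norm x \<le> 1" and x0: "\<forall>l. l \<notin> set (L @ [i]) \<longrightarrow> x $ l = 0"
    define x' where "x' = x - (x $ i) *\<^sub>R axis i 1"
    have x'c: "x' $ l = (if l = i then 0 else x $ l)" for l
      by (simp add: x'_def axis_def)
    have x'0: "\<forall>l. l \<notin> set L \<longrightarrow> x' $ l = 0" using x0 by (auto simp: x'c)
    have nx': "norm x' \<le> norm x" by (rule norm_le_componentwise_cart) (simp add: x'c)
    have nxt: "norm (x' + t *\<^sub>R axis i 1) \<le> norm x" if "\<bar>t\<bar> \<le> \<bar>x $ i\<bar>" for t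
      by (rule norm_le_componentwise_cart) (use that in \<open>auto simp: x'c axis_def\<close>)
    have xi: "\<bar>x $ i\<bar> \<le> norm x" using component_le_norm_cart by blast
    have "\<exists>t. \<bar>t\<bar> \<le> \<bar>x $ i\<bar> \<and> g (x' + (x $ i) *\<^sub>R axis i 1) =
        (\<Sum>a<k. D a (x' + 0 *\<^sub>R axis i 1) / fact a * (x $ i) ^ a)
          + D k (x' + t *\<^sub>R axis i 1) / fact k * (x $ i) ^ k"
    proof (rule Maclaurin_bi_le[of "\<lambda>a t. D a (x' + t *\<^sub>R axis i 1)" "\<lambda>t. g (x' + t *\<^sub>R axis i 1)"])
      show "(\<lambda>t. D 0 (x' + t *\<^sub>R axis i 1)) = (\<lambda>t. g (x' + t *\<^sub>R axis i 1))"
        by (simp add: D_def)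
      show "\<forall>m t. m < k \<and> \<bar>t\<bar> \<le> \<bar>x $ i\<bar> \<longrightarrow>
          ((\<lambda>t. D m (x' + t *\<^sub>R axis i 1)) has_real_derivative D (Suc m) (x' + t *\<^sub>R axis i 1)) (at t)"
      proof (intro allI impI)
        fix m t assume "m < k \<and> \<bar>t\<bar> \<le> \<bar>x $ i\<bar>"
        then have "C_scalar (Suc (k - Suc m)) (D m)"
          using CD[of m] by (simp add: Suc_diff_Suc del: C_scalar.simps)
        from partial_deriv_has_derivative[OF this, of x' i t]
        show "((\<lambda>t. D m (x' + t *\<^sub>R axis i 1)) has_real_derivative D (Suc m) (x' + t *\<^sub>R axis i 1)) (at t)"
          by (simp add: D_def)
      qed
    qed
    then obtain t where t: "\<bar>t\<bar> \<le> \<bar>x $ i\<bar>" and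
      gx: "g x = (\<Sum>a<k. D a x' / fact a * (x $ i) ^ a) + D k (x' + t *\<^sub>R axis i 1) / fact k * (x $ i) ^ k"
      by (auto simp: x'_def)
    have fk: "(fact k :: real) \<ge> 1" by (simp add: fact_ge_1)
    have b1: "\<bar>D k (x' + t *\<^sub>R axis i 1) / fact k * (x $ i) ^ k\<bar> \<le> B * norm x ^ k"
    proof -
      have "\<bar>D k (x' + t *\<^sub>R axis i 1)\<bar> / fact k \<le> B / 1"
        using B[of "x' + t *\<^sub>R axis i 1"] nxt[OF t] x1 fk B0 by (intro frac_le) auto
      moreover have "\<bar>x $ i\<bar> ^ k \<le> norm x ^ k" using xi by (intro power_mono) auto
      ultimately have "\<bar>D k (x' + t *\<^sub>R axis i 1)\<bar> / fact k * \<bar>x $ i\<bar> ^ k \<le> B * norm x ^ k"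
        using B0 by (intro mult_mono) auto
      then show ?thesis by (simp add: abs_mult power_abs)
    qed
    have b2: "\<bar>(D a x' - P a x') / fact a * (x $ i) ^ a\<bar> \<le> K a * norm x ^ k" if "a < k" for a
    proof -
      have "\<bar>D a x' - P a x'\<bar> \<le> K a * norm x' ^ (k - a)" using K[of a x'] that x'0 nx' x1 by auto
      also have "\<dots> \<le> K a * norm x ^ (k - a)"
        using K0[of a] nx' that by (intro mult_left_mono power_mono) auto
      finally have 1: "\<bar>D a x' - P a x'\<bar> \<le> K a * norm x ^ (k - a)" .
      have "\<bar>D a x' - P a x'\<bar> / fact a \<le> K a * norm x ^ (k - a) / 1"
        using 1 fact_ge_1[of a, where 'a=real] K0[of a] that by (intro frac_le) auto
      moreover have "\<bar>x $ i\<bar> ^ a \<le> norm x ^ a" using xi by (intro power_mono) auto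
      ultimately have "\<bar>D a x' - P a x'\<bar> / fact a * \<bar>x $ i\<bar> ^ a \<le> (K a * norm x ^ (k - a)) * norm x ^ a"
        using K0[of a] that by (intro mult_mono) auto
      also have "\<dots> = K a * norm x ^ k" using that by (simp add: mult.assoc flip: power_add)
      finally show ?thesis by (simp add: abs_mult power_abs)
    qed
    have finJ: "finite (J b)" for b
      by (rule finite_subset[OF _ finite_multi_indices[of b]]) (auto simp: J_def multi_indices_def)
    have mp: "multi_power x (\<alpha>(i := a)) = multi_power x' \<alpha> * (x $ i) ^ a"
      and mf: "multi_fact (\<alpha>(i := a)) = multi_fact \<alpha> * fact a"
      and sm: "(\<Sum>l\<in>UNIV. (\<alpha>(i := a)) l) = (\<Sum>l\<in>UNIV. \<alpha> l) + a"
      if "\<alpha> i = 0" for \<alpha> a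
      using that by (simp_all add: multi_power_def multi_fact_def prod.remove[of UNIV i] sum.remove[of UNIV i] x'c)
    have fo: "foldr (\<lambda>l. partial_deriv l ^^ (\<alpha>(i := a)) l) (L @ [i]) g =
        foldr (\<lambda>l. partial_deriv l ^^ \<alpha> l) L (D a)" for \<alpha> a
    proof -
      have "foldr (\<lambda>l. partial_deriv l ^^ (\<alpha>(i := a)) l) L (D a) = foldr (\<lambda>l. partial_deriv l ^^ \<alpha> l) L (D a)"
        using iL by (intro foldr_cong) auto
      then show ?thesis by (simp add: D_def)
    qed
    \<comment> \<open>A multi-index on the longer list is a pair of its entry at i and its
      restriction to L, and all factors of the Taylor term split accordingly.\<close>
    have "(\<Sum>a<k. P a x' / fact a * (x $ i) ^ a) = (\<Sum>a<k. \<Sum>\<alpha>\<in>J (k - a).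
       foldr (\<lambda>i. partial_deriv i ^^ \<alpha> i) L (D a) 0 / multi_fact \<alpha> * multi_power x' \<alpha> / fact a * (x $ i) ^ a)"
      unfolding P_def by (simp add: sum_divide_distrib sum_distrib_right)
    also have "\<dots> = (\<Sum>(a,\<alpha>)\<in>Sigma {..<k} (\<lambda>a. J (k - a)).
       foldr (\<lambda>i. partial_deriv i ^^ \<alpha> i) L (D a) 0 / multi_fact \<alpha> * multi_power x' \<alpha> / fact a * (x $ i) ^ a)"
      using finJ by (subst sum.Sigma) auto
    also have "\<dots> = (\<Sum>\<alpha>\<in>J'.
       foldr (\<lambda>i. partial_deriv i ^^ \<alpha> i) (L @ [i]) g 0 / multi_fact \<alpha> * multi_power x \<alpha>)"
    proof (rule sum.reindex_bij_witness[where i = "\<lambda>\<alpha>. (\<alpha> i, \<alpha>(i := 0))" and j = "\<lambda>(a,\<alpha>). \<alpha>(i := a)"])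
      fix p assume p: "p \<in> Sigma {..<k} (\<lambda>a. J (k - a))"
      obtain a \<alpha> where pa: "p = (a, \<alpha>)" by fastforce
      have a0: "\<alpha> i = 0" and ak: "a < k" and sa: "(\<Sum>l\<in>UNIV. \<alpha> l) < k - a"
        using p iL by (auto simp: J_def pa)
      show "(\<lambda>\<alpha>. (\<alpha> i, \<alpha>(i := 0))) ((\<lambda>(a, \<alpha>). \<alpha>(i := a)) p) = p"
        using a0 by (auto simp: pa fun_eq_iff)
      show "(\<lambda>(a, \<alpha>). \<alpha>(i := a)) p \<in> J'"
        using p sm[of \<alpha> a, OF a0] sa ak by (auto simp: pa J'_def J_def)
      show "foldr (\<lambda>l. partial_deriv l ^^ ((\<lambda>(a, \<alpha>). \<alpha>(i := a)) p) l) (L @ [i]) g 0 /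
              multi_fact ((\<lambda>(a, \<alpha>). \<alpha>(i := a)) p) * multi_power x ((\<lambda>(a, \<alpha>). \<alpha>(i := a)) p) =
           (case p of (a, \<alpha>) \<Rightarrow> foldr (\<lambda>i. partial_deriv i ^^ \<alpha> i) L (D a) 0 / multi_fact \<alpha> *
              multi_power x' \<alpha> / fact a * (x $ i) ^ a)"
        unfolding pa split fo mp[of \<alpha> a, OF a0] mf[of \<alpha> a, OF a0] by simp
    next
      fix \<alpha> assume al: "\<alpha> \<in> J'"
      have "(\<Sum>l\<in>UNIV. \<alpha> l) = (\<Sum>l\<in>UNIV. (\<alpha>(i := 0)) l) + \<alpha> i"
        using sm[of "\<alpha>(i := 0)" "\<alpha> i"] by simp
      then show "(\<alpha> i, \<alpha>(i := 0)) \<in> Sigma {..<k} (\<lambda>a. J (k - a))"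
        using al by (auto simp: J_def J'_def)
    qed auto
    finally have eq: "(\<Sum>a<k. P a x' / fact a * (x $ i) ^ a) = (\<Sum>\<alpha>\<in>J'.
       foldr (\<lambda>i. partial_deriv i ^^ \<alpha> i) (L @ [i]) g 0 / multi_fact \<alpha> * multi_power x \<alpha>)" .
    have "g x - (\<Sum>\<alpha>\<in>J'. foldr (\<lambda>i. partial_deriv i ^^ \<alpha> i) (L @ [i]) g 0 / multi_fact \<alpha> * multi_power x \<alpha>)
       = D k (x' + t *\<^sub>R axis i 1) / fact k * (x $ i) ^ k + (\<Sum>a<k. (D a x' - P a x') / fact a * (x $ i) ^ a)"
      unfolding eq[symmetric] gx by (simp add: diff_divide_distrib left_diff_distrib sum_subtractf)
    also have "\<bar>\<dots>\<bar> \<le> B * norm x ^ k + (\<Sum>a<k. K a * norm x ^ k)"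
      by (rule order.trans[OF abs_triangle_ineq] add_mono b1 order.trans[OF sum_abs] sum_mono b2)+ auto
    also have "\<dots> = (B + (\<Sum>a<k. K a)) * norm x ^ k"
      by (simp add: sum_distrib_right distrib_right)
    finally show "\<bar>g x - (\<Sum>\<alpha>\<in>{\<alpha>. (\<forall>l. l \<notin> set (L @ [i]) \<longrightarrow> \<alpha> l = 0) \<and> (\<Sum>i\<in>UNIV. \<alpha> i) < k}.
       foldr (\<lambda>i. partial_deriv i ^^ \<alpha> i) (L @ [i]) g 0 / multi_fact \<alpha> * multi_power x \<alpha>)\<bar>
        \<le> (B + (\<Sum>a<k. K a)) * norm x ^ k"
      unfolding J'_def .
  qed
qed

lemma multivariate_Taylor:
  fixes g :: "real^'d::{finite,linorder} \<Rightarrow> real"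
  assumes "C_scalar k g" "k \<ge> 1"
  shows "\<exists>K\<ge>0. \<forall>x. norm x \<le> 1 \<longrightarrow>
    \<bar>g x - (\<Sum>\<alpha>\<in>multi_indices (k - 1). multi_partial \<alpha> g 0 / multi_fact \<alpha> * multi_power x \<alpha>)\<bar>
      \<le> K * norm x ^ k"
proof -
  have "{\<alpha>::'d\<Rightarrow>nat. (\<forall>i. i \<notin> set (sorted_list_of_set UNIV) \<longrightarrow> \<alpha> i = 0) \<and> (\<Sum>i\<in>UNIV. \<alpha> i) < k}
      = multi_indices (k - 1)"
    using assms(2) by (auto simp: multi_indices_def)
  then show ?thesis
    using Taylor_along_coordinates[of "sorted_list_of_set (UNIV::'d set)" k g] assms(1)
    unfolding multi_partial_def by simp
qed

section \<open>Derivatives of polynomials at the origin\<close>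

text \<open>The exponents \<open>e s\<close> are attached to an arbitrary index \<open>s\<close>, so that lowering them keeps the shape of
  the sum. Truncated subtraction is harmless: once an exponent has reached \<open>0\<close>, the product of the
  \<open>e s i - t\<close> contains the factor \<open>0\<close>.\<close>

lemma iterate_partial_deriv_multi_power_sum:
  fixes b :: "'s \<Rightarrow> real" and e :: "'s \<Rightarrow> 'd::finite \<Rightarrow> nat"
  shows "(partial_deriv i ^^ a) (\<lambda>x. \<Sum>s\<in>B. b s * multi_power x (e s)) =
    (\<lambda>x. \<Sum>s\<in>B. (b s * (\<Prod>t<a. real (e s i - t))) * multi_power x ((e s)(i := e s i - a)))"
proof (induction a)
  case (Suc a)
  have mp: "multi_power (x + t *\<^sub>R axis i 1) \<beta> = (x $ i + t) ^ \<beta> i * (\<Prod>l\<in>UNIV - {i}. (x $ l) ^ \<beta> l)"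
    for x :: "real^'d" and t \<beta>
    unfolding multi_power_def by (subst prod.remove[of UNIV i]) (auto simp: axis_def intro!: prod.cong)
  have pd: "partial_deriv i (\<lambda>x. \<Sum>s\<in>B. c s * multi_power x (h s)) x =
      (\<Sum>s\<in>B. c s * real (h s i) * multi_power x ((h s)(i := h s i - 1)))" for c h x
  proof -
    have "((\<lambda>t. \<Sum>s\<in>B. c s * multi_power (x + t *\<^sub>R axis i 1) (h s)) has_real_derivative
       (\<Sum>s\<in>B. c s * real (h s i) * multi_power x ((h s)(i := h s i - 1)))) (at 0)"
      unfolding mp using mp[of x 0]
      by (auto intro!: derivative_eq_intros sum.cong)
    then show ?thesis unfolding partial_deriv_def by (rule DERIV_imp_deriv)
  qed
  show ?case
    unfolding funpow.simps o_apply Suc.IH pd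
    by (intro ext sum.cong) (simp_all add: mult_ac fun_upd_def cong: if_cong)
qed simp

lemma foldr_partial_deriv_multi_power_sum:
  fixes b :: "'s \<Rightarrow> real" and e :: "'s \<Rightarrow> 'd::finite \<Rightarrow> nat"
  assumes "distinct L"
  shows "foldr (\<lambda>i. partial_deriv i ^^ \<alpha> i) L (\<lambda>x. \<Sum>s\<in>B. b s * multi_power x (e s)) =
    (\<lambda>x. \<Sum>s\<in>B. (b s * (\<Prod>i\<in>set L. \<Prod>t<\<alpha> i. real (e s i - t))) *
       multi_power x (\<lambda>i. if i \<in> set L then e s i - \<alpha> i else e s i))"
  using assms
proof (induction L)
  case (Cons i L)
  then have IH: "foldr (\<lambda>i. partial_deriv i ^^ \<alpha> i) L (\<lambda>x. \<Sum>s\<in>B. b s * multi_power x (e s)) =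
    (\<lambda>x. \<Sum>s\<in>B. (b s * (\<Prod>i\<in>set L. \<Prod>t<\<alpha> i. real (e s i - t))) *
       multi_power x (\<lambda>i. if i \<in> set L then e s i - \<alpha> i else e s i))" by simp
  have i: "i \<notin> set L" using Cons.prems by simp
  have upd: "(\<lambda>l. if l \<in> set L then e s l - \<alpha> l else e s l)(i := e s i - \<alpha> i) =
     (\<lambda>l. if l \<in> set (i # L) then e s l - \<alpha> l else e s l)" for s
    using i by (auto simp: fun_eq_iff)
  have ei: "(if i \<in> set L then e s i - \<alpha> i else e s i) = e s i" for s
    using i by simp
  show ?case
    unfolding foldr.simps o_apply IH iterate_partial_deriv_multi_power_sum ei upd
    using i by (intro ext sum.cong) (simp_all add: mult_ac)
qed simp

text \<open>Differentiating \<open>x\<^sup>\<beta>\<close> gives a product of falling factorials, zero if \<open>\<beta> i < \<alpha> i\<close> for some \<open>i\<close>, times a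
  power of \<open>x\<close>, zero at the origin if \<open>\<beta> i > \<alpha> i\<close> for some \<open>i\<close>. Only \<open>\<beta> = \<alpha>\<close> survives.\<close>

lemma multi_partial_polynomial_at_0:
  fixes b :: "('d::{finite,linorder} \<Rightarrow> nat) \<Rightarrow> real"
  shows "multi_partial \<alpha> (\<lambda>x. \<Sum>\<beta>\<in>multi_indices r. b \<beta> * multi_power x \<beta>) 0 =
    (if \<alpha> \<in> multi_indices r then b \<alpha> * multi_fact \<alpha> else 0)"
proof -
  have "multi_partial \<alpha> (\<lambda>x. \<Sum>\<beta>\<in>multi_indices r. b \<beta> * multi_power x \<beta>) 0 =
     (\<Sum>\<beta>\<in>multi_indices r. (b \<beta> * (\<Prod>i\<in>UNIV. \<Prod>t<\<alpha> i. real (\<beta> i - t))) *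
       multi_power 0 (\<lambda>i. \<beta> i - \<alpha> i))"
    unfolding multi_partial_def by (subst foldr_partial_deriv_multi_power_sum) simp_all
  also have "\<dots> = (\<Sum>\<beta>\<in>multi_indices r. if \<beta> = \<alpha> then b \<alpha> * multi_fact \<alpha> else 0)"
  proof (rule sum.cong)
    fix \<beta> :: "'d \<Rightarrow> nat"
    show "(b \<beta> * (\<Prod>i\<in>UNIV. \<Prod>t<\<alpha> i. real (\<beta> i - t))) * multi_power 0 (\<lambda>i. \<beta> i - \<alpha> i) =
       (if \<beta> = \<alpha> then b \<alpha> * multi_fact \<alpha> else 0)"
    proof (cases "\<beta> = \<alpha>")
      case True
      have "(\<Prod>t<n. real (n - t)) = fact n" for n
        by (simp add: fact_prod_rev atLeast0LessThan)
      then show ?thesis using True by (simp add: multi_fact_def multi_power_def)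
    next
      case False
      then obtain i where "\<beta> i \<noteq> \<alpha> i" by auto
      then consider "\<beta> i < \<alpha> i" | "\<beta> i > \<alpha> i" by linarith
      then show ?thesis
      proof cases
        case 1
        then have "(\<Prod>t<\<alpha> i. real (\<beta> i - t)) = 0" by (intro prod_zero) auto
        then have "(\<Prod>i\<in>UNIV. \<Prod>t<\<alpha> i. real (\<beta> i - t)) = 0" by (intro prod_zero) auto
        then show ?thesis using False by simp
      next
        case 2
        then have "multi_power 0 (\<lambda>i. \<beta> i - \<alpha> i) = 0" unfolding multi_power_def
          by (intro prod_zero) auto
        then show ?thesis using False by simp
      qed
    qed
  qed simp
  finally show ?thesis by (simp add: finite_multi_indices)
qed

section \<open>Stability of polynomial least squares\<close>

text \<open>The weights \<open>w a b\<close> recover the coefficient of \<open>t\<^sup>a\<close> of a polynomial of degree at most \<open>r\<close> from its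
  values at \<open>r + 1\<close> distinct nodes: \<open>w a b\<close> is the coefficient of \<open>t\<^sup>a\<close> in the \<open>b\<close>-th Lagrange basis
  polynomial.\<close>

lemma Lagrange_dual_weights:
  fixes t :: "nat \<Rightarrow> real"
  assumes inj: "inj_on t {..r}"
  shows "\<exists>w. \<forall>a\<le>r. \<forall>g\<le>r. (\<Sum>b\<le>r. w a b * t b ^ g) = (if a = g then 1 else 0)"
proof -
  define ell where "ell = (\<lambda>b. \<Prod>c\<in>{..r} - {b}. [: - t c / (t b - t c), 1 / (t b - t c) :])"
  have deg: "degree (ell b) \<le> r" if "b \<le> r" for b
  proof -
    have "degree (ell b) \<le> sum (degree \<circ> (\<lambda>c. [: - t c / (t b - t c), 1 / (t b - t c) :])) ({..r} - {b})"
      unfolding ell_def by (rule degree_prod_sum_le) simp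
    also have "\<dots> \<le> (\<Sum>c\<in>{..r} - {b}. 1)" by (intro sum_mono) simp
    finally show ?thesis using that by simp
  qed
  have val: "poly (ell b) (t c) = (if b = c then 1 else 0)" if "b \<le> r" "c \<le> r" for b c
  proof (cases "b = c")
    case True
    have "t c - t c' \<noteq> 0" if "c' \<in> {..r} - {c}" for c'
      using inj \<open>c \<le> r\<close> that by (auto dest: inj_onD)
    then show ?thesis using True
      by (auto simp: ell_def poly_prod diff_divide_distrib[symmetric] intro!: prod.neutral)
  next
    case False
    then have "poly (ell b) (t c) = 0"
      unfolding ell_def poly_prod using that by (intro prod_zero) auto
    then show ?thesis using False by simp
  qed
  have "(\<Sum>b\<le>r. coeff (ell b) a * t b ^ g) = (if a = g then 1 else 0)" if "g \<le> r" for a g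
  proof -
    have "(\<Sum>b\<le>r. smult (t b ^ g) (ell b)) = monom 1 g"
    proof (rule poly_eqI_degree[where A = "t ` {..r}"])
      fix x assume "x \<in> t ` {..r}"
      then obtain c where c: "c \<le> r" "x = t c" by auto
      have "(\<Sum>b\<le>r. t b ^ g * poly (ell b) (t c)) = (\<Sum>b\<le>r. if c = b then t c ^ g else 0)"
        by (intro sum.cong) (auto simp: val c)
      then show "poly (\<Sum>b\<le>r. smult (t b ^ g) (ell b)) x = poly (monom 1 g) x"
        using c by (simp add: poly_sum poly_monom)
    next
      have "degree (\<Sum>b\<le>r. smult (t b ^ g) (ell b)) \<le> r"
        by (intro degree_sum_le) (auto intro: order.trans[OF degree_smult_le] deg)
      then show "degree (\<Sum>b\<le>r. smult (t b ^ g) (ell b)) < card (t ` {..r})"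
        by (simp add: card_image[OF inj])
      show "degree (monom 1 g :: real poly) < card (t ` {..r})"
        using that by (simp add: card_image[OF inj] degree_monom_eq)
    qed
    then have "coeff (\<Sum>b\<le>r. smult (t b ^ g) (ell b)) a = coeff (monom 1 g) a" by simp
    then show ?thesis by (simp add: coeff_sum mult.commute eq_commute)
  qed
  then show ?thesis by (intro exI[of _ "\<lambda>a b. coeff (ell b) a"]) auto
qed

text \<open>On a product grid, products of the one-dimensional weights express each coefficient as a linear
  combination of grid values. Moving the grid points by less than \<open>\<delta>\<close> changes the values by at most a
  small multiple of \<open>\<Sum>\<^sub>\<alpha> |\<theta> \<alpha>|\<close>, and this error is absorbed on the left.\<close>

lemma grid_bounds_coefficients:
  fixes r :: nat
  shows "\<exists>(G :: ('d::finite \<Rightarrow> nat) set) (z :: ('d \<Rightarrow> nat) \<Rightarrow> real^'d) \<delta> K.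
    finite G \<and> (\<forall>\<beta>\<in>G. norm (z \<beta>) \<le> 1/2) \<and> 0 < \<delta> \<and> \<delta> \<le> 1/2 \<and> 0 \<le> K \<and>
    (\<forall>\<theta> u. (\<forall>\<beta>\<in>G. u \<beta> \<in> ball (z \<beta>) \<delta>) \<longrightarrow>
      (\<Sum>\<alpha>\<in>multi_indices r. \<bar>\<theta> \<alpha>\<bar>) \<le>
        K * (\<Sum>\<beta>\<in>G. \<bar>\<Sum>\<alpha>\<in>multi_indices r. \<theta> \<alpha> * multi_power (u \<beta>) \<alpha>\<bar>))"
proof -
  \<comment> \<open>With these nodes all grid points have norm at most 1/2, which leaves room for
    cells of radius 1/2 inside the unit ball.\<close>
  define t where "t = (\<lambda>b::nat. real b / (2 * real (r + 1) * real CARD('d)))"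
  define G where "G = (PiE UNIV (\<lambda>_. {..r}) :: ('d \<Rightarrow> nat) set)"
  define z :: "('d \<Rightarrow> nat) \<Rightarrow> real^'d" where "z = (\<lambda>\<beta>. \<chi> i. t (\<beta> i))"
  define MI where "MI = (multi_indices r :: ('d \<Rightarrow> nat) set)"
  have finMI: "finite MI" by (simp add: MI_def finite_multi_indices)
  have finG: "finite G" unfolding G_def by (intro finite_PiE) auto
  have "inj_on t {..r}" by (auto simp: inj_on_def t_def)
  then obtain w where w: "\<And>a g. a \<le> r \<Longrightarrow> g \<le> r \<Longrightarrow> (\<Sum>b\<le>r. w a b * t b ^ g) = (if a = g then 1 else 0)"
    using Lagrange_dual_weights by blast
  define W where "W = (\<lambda>\<alpha> \<beta>. \<Prod>i\<in>(UNIV::'d set). w (\<alpha> i) (\<beta> i))"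
  have le: "\<alpha> i \<le> r" if "\<alpha> \<in> MI" for \<alpha> i
    using that member_le_sum[of i UNIV \<alpha>] by (auto simp: MI_def multi_indices_def)
  have dual: "(\<Sum>\<beta>\<in>G. W \<alpha> \<beta> * multi_power (z \<beta>) \<gamma>) = (if \<alpha> = \<gamma> then 1 else 0)"
    if "\<alpha> \<in> MI" "\<gamma> \<in> MI" for \<alpha> \<gamma>
  proof -
    have "(\<Sum>\<beta>\<in>G. W \<alpha> \<beta> * multi_power (z \<beta>) \<gamma>) = (\<Sum>\<beta>\<in>G. \<Prod>i\<in>UNIV. w (\<alpha> i) (\<beta> i) * t (\<beta> i) ^ \<gamma> i)"
      by (simp add: W_def multi_power_def z_def prod.distrib)
    also have "\<dots> = (\<Prod>i\<in>UNIV. \<Sum>b\<le>r. w (\<alpha> i) b * t b ^ \<gamma> i)"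
      unfolding G_def by (subst prod_sum_PiE) auto
    also have "\<dots> = (\<Prod>i\<in>UNIV. if \<alpha> i = \<gamma> i then 1 else 0)"
      using le that by (simp add: w)
    also have "\<dots> = (if \<alpha> = \<gamma> then 1 else 0)"
      by (auto simp: fun_eq_iff)
    finally show ?thesis .
  qed
  define A where "A = (\<Sum>\<alpha>\<in>MI. \<Sum>\<beta>\<in>G. \<bar>W \<alpha> \<beta>\<bar>)"
  \<comment> \<open>The tolerance for the monomials is chosen so that the perturbation costs at
    most half of the sum of the coefficients.\<close>
  define \<eta> where "\<eta> = 1 / (2 * (A + 1))"
  have A0: "A \<ge> 0" unfolding A_def by (intro sum_nonneg) auto
  have eta: "\<eta> > 0" "A * \<eta> \<le> 1/2" using A0 by (auto simp: \<eta>_def field_simps)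
  have "\<forall>\<^sub>F v in nhds 0. \<forall>\<beta>\<in>G. \<forall>\<alpha>\<in>MI. dist (multi_power (z \<beta> + v) \<alpha>) (multi_power (z \<beta>) \<alpha>) < \<eta>"
  proof (intro eventually_ball_finite finG finMI ballI)
    fix \<beta> \<alpha>
    have "((\<lambda>v. multi_power (z \<beta> + v) \<alpha>) \<longlongrightarrow> multi_power (z \<beta> + 0) \<alpha>) (nhds 0)"
      unfolding multi_power_def by (intro tendsto_intros filterlim_ident)
    then show "\<forall>\<^sub>F v in nhds 0. dist (multi_power (z \<beta> + v) \<alpha>) (multi_power (z \<beta>) \<alpha>) < \<eta>"
      using eta by (auto dest: tendstoD)
  qed
  then obtain d where d: "d > 0" and
    near: "\<And>v \<beta> \<alpha>. dist v 0 < d \<Longrightarrow> \<beta> \<in> G \<Longrightarrow> \<alpha> \<in> MI \<Longrightarrow>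
      dist (multi_power (z \<beta> + v) \<alpha>) (multi_power (z \<beta>) \<alpha>) < \<eta>"
    unfolding eventually_nhds_metric by blast
  define \<delta> where "\<delta> = min d (1/2)"
  have nz: "norm (z \<beta>) \<le> 1/2" if "\<beta> \<in> G" for \<beta>
  proof -
    have "norm (z \<beta>) \<le> (\<Sum>i\<in>UNIV. \<bar>z \<beta> $ i\<bar>)" by (rule norm_le_l1_cart)
    also have "\<dots> \<le> (\<Sum>i\<in>(UNIV::'d set). 1 / (2 * real CARD('d)))"
    proof (rule sum_mono)
      fix i
      have "\<beta> i \<le> r" using that by (auto simp: G_def PiE_def Pi_def)
      then have "real (\<beta> i) / real (r + 1) \<le> 1" by simp
      then have "real (\<beta> i) / real (r + 1) / (2 * real CARD('d)) \<le> 1 / (2 * real CARD('d))"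
        by (intro divide_right_mono) auto
      then show "\<bar>z \<beta> $ i\<bar> \<le> 1 / (2 * real CARD('d))"
        by (simp add: z_def t_def mult_ac)
    qed
    also have "\<dots> = 1/2" by simp
    finally show ?thesis .
  qed
  have main: "(\<Sum>\<alpha>\<in>MI. \<bar>\<theta> \<alpha>\<bar>) \<le> 2 * A * (\<Sum>\<beta>\<in>G. \<bar>\<Sum>\<alpha>\<in>MI. \<theta> \<alpha> * multi_power (u \<beta>) \<alpha>\<bar>)"
    if u: "\<forall>\<beta>\<in>G. u \<beta> \<in> ball (z \<beta>) \<delta>" for \<theta> u
  proof -
    define P where "P = (\<lambda>x. \<Sum>\<alpha>\<in>MI. \<theta> \<alpha> * multi_power x \<alpha>)"
    define T where "T = (\<Sum>\<alpha>\<in>MI. \<bar>\<theta> \<alpha>\<bar>)"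
    define Q where "Q = (\<Sum>\<beta>\<in>G. \<bar>P (u \<beta>)\<bar>)"
    have th: "\<theta> \<alpha> = (\<Sum>\<beta>\<in>G. W \<alpha> \<beta> * P (z \<beta>))" if "\<alpha> \<in> MI" for \<alpha>
    proof -
      have "(\<Sum>\<beta>\<in>G. W \<alpha> \<beta> * P (z \<beta>)) = (\<Sum>\<beta>\<in>G. \<Sum>\<gamma>\<in>MI. \<theta> \<gamma> * (W \<alpha> \<beta> * multi_power (z \<beta>) \<gamma>))"
        unfolding P_def by (simp add: sum_distrib_left mult_ac)
      also have "\<dots> = (\<Sum>\<gamma>\<in>MI. \<theta> \<gamma> * (\<Sum>\<beta>\<in>G. W \<alpha> \<beta> * multi_power (z \<beta>) \<gamma>))"
        by (subst sum.swap) (simp add: sum_distrib_left)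
      also have "\<dots> = (\<Sum>\<gamma>\<in>MI. if \<alpha> = \<gamma> then \<theta> \<gamma> else 0)"
        using that by (intro sum.cong) (simp_all add: dual)
      finally show ?thesis using that finMI by simp
    qed
    have Pz: "\<bar>P (z \<beta>)\<bar> \<le> Q + \<eta> * T" if "\<beta> \<in> G" for \<beta>
    proof -
      have dv: "dist (u \<beta> - z \<beta>) 0 < d"
        using u that by (auto simp: \<delta>_def dist_norm norm_minus_commute)
      have "P (z \<beta>) - P (u \<beta>) = (\<Sum>\<alpha>\<in>MI. \<theta> \<alpha> * (multi_power (z \<beta>) \<alpha> - multi_power (u \<beta>) \<alpha>))"
        by (simp add: P_def sum_subtractf right_diff_distrib)
      also have "\<bar>\<dots>\<bar> \<le> (\<Sum>\<alpha>\<in>MI. \<bar>\<theta> \<alpha>\<bar> * \<eta>)"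
      proof (intro order.trans[OF sum_abs] sum_mono)
        fix \<alpha> assume "\<alpha> \<in> MI"
        then have "\<bar>multi_power (z \<beta>) \<alpha> - multi_power (u \<beta>) \<alpha>\<bar> \<le> \<eta>"
          using near[OF dv that, of \<alpha>] by (simp add: dist_real_def abs_minus_commute)
        then show "\<bar>\<theta> \<alpha> * (multi_power (z \<beta>) \<alpha> - multi_power (u \<beta>) \<alpha>)\<bar> \<le> \<bar>\<theta> \<alpha>\<bar> * \<eta>"
          by (simp add: abs_mult mult_left_mono)
      qed
      finally have "\<bar>P (z \<beta>) - P (u \<beta>)\<bar> \<le> \<eta> * T"
        by (simp add: T_def sum_distrib_left mult.commute)
      moreover have "\<bar>P (u \<beta>)\<bar> \<le> Q" unfolding Q_def using that finG
        by (intro member_le_sum[of \<beta> G "\<lambda>\<beta>. \<bar>P (u \<beta>)\<bar>"]) auto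
      ultimately show ?thesis by linarith
    qed
    have "T \<le> (\<Sum>\<alpha>\<in>MI. \<Sum>\<beta>\<in>G. \<bar>W \<alpha> \<beta>\<bar> * (Q + \<eta> * T))"
      unfolding T_def
    proof (rule sum_mono)
      fix \<alpha> assume "\<alpha> \<in> MI"
      then have "\<bar>\<theta> \<alpha>\<bar> = \<bar>\<Sum>\<beta>\<in>G. W \<alpha> \<beta> * P (z \<beta>)\<bar>" using th by simp
      also have "\<dots> \<le> (\<Sum>\<beta>\<in>G. \<bar>W \<alpha> \<beta>\<bar> * (Q + \<eta> * T))"
        by (intro order.trans[OF sum_abs] sum_mono) (auto simp: abs_mult Pz intro!: mult_left_mono)
      finally show "\<bar>\<theta> \<alpha>\<bar> \<le> (\<Sum>\<beta>\<in>G. \<bar>W \<alpha> \<beta>\<bar> * (Q + \<eta> * (\<Sum>\<alpha>\<in>MI. \<bar>\<theta> \<alpha>\<bar>)))"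
        by (simp add: T_def)
    qed
    also have "\<dots> = A * Q + (A * \<eta>) * T"
      unfolding A_def by (simp only: sum_distrib_right[symmetric]) (simp only: algebra_simps)
    also have "\<dots> \<le> A * Q + 1/2 * T"
      using eta by (intro add_left_mono mult_right_mono) (auto simp: T_def intro!: sum_nonneg)
    finally show ?thesis unfolding T_def Q_def P_def by simp
  qed
  show ?thesis
    using finG nz d A0 main unfolding MI_def
    by (intro exI[of _ G] exI[of _ z] exI[of _ \<delta>] exI[of _ "2 * A"]) (auto simp: \<delta>_def)
qed

text \<open>The conclusion is what a lower bound of order \<open>\<nu>\<close> for the eigenvalues of the Gram matrix of the
  monomials would give; the premise on \<open>\<theta>\<close> is the inequality satisfied by the difference of two polynomials of which
  one has the smaller residual sum of squares and the other has the residuals \<open>\<xi>\<close>. Here it is required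
  of every configuration of points that puts at least \<open>\<nu>\<close> of them in each of the cells
  \<open>ball (z \<beta>) \<delta>\<close>.\<close>

definition stabilizes_least_squares ::
    "nat \<Rightarrow> 'b set \<Rightarrow> ('b \<Rightarrow> real^'d::finite) \<Rightarrow> real \<Rightarrow> real \<Rightarrow> bool" where
  "stabilizes_least_squares r G z \<delta> K \<longleftrightarrow>
    (\<forall>(I :: nat set) v \<nu> \<xi> \<theta>. finite I \<longrightarrow> \<nu> > 0 \<longrightarrow>
      (\<forall>\<beta>\<in>G. \<nu> \<le> real (card {i\<in>I. v i \<in> ball (z \<beta>) \<delta>})) \<longrightarrow>
      (\<Sum>i\<in>I. (\<Sum>\<alpha>\<in>multi_indices r. \<theta> \<alpha> * multi_power (v i) \<alpha>)\<^sup>2) \<le>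
        2 * (\<Sum>i\<in>I. \<xi> i * (\<Sum>\<alpha>\<in>multi_indices r. \<theta> \<alpha> * multi_power (v i) \<alpha>)) \<longrightarrow>
      (\<Sum>\<alpha>\<in>multi_indices r. \<bar>\<theta> \<alpha>\<bar>) \<le>
        K / \<nu> * (\<Sum>\<alpha>\<in>multi_indices r. \<bar>\<Sum>i\<in>I. \<xi> i * multi_power (v i) \<alpha>\<bar>))"

text \<open>Some point \<open>i\<close> of each cell has \<open>P (v i)\<^sup>2\<close> at most the average over the cell, hence at most
  \<open>(\<Sum>i\<in>I. P (v i)\<^sup>2) / \<nu>\<close>, where \<open>P\<close> is the polynomial with coefficients \<open>\<theta>\<close>. Evaluating at these
  points bounds \<open>(\<Sum>\<^sub>\<alpha> |\<theta> \<alpha>|)\<^sup>2\<close> by a multiple of \<open>(\<Sum>i\<in>I. P (v i)\<^sup>2) / \<nu>\<close>; the least-squares premise is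
  linear in \<open>\<theta>\<close> on its right-hand side, so that one factor \<open>\<Sum>\<^sub>\<alpha> |\<theta> \<alpha>|\<close> cancels.\<close>

lemma occupied_cells_control_least_squares:
  fixes r :: nat
  shows "\<exists>(G :: ('d::finite \<Rightarrow> nat) set) (z :: ('d \<Rightarrow> nat) \<Rightarrow> real^'d) \<delta> K.
    finite G \<and> (\<forall>\<beta>\<in>G. norm (z \<beta>) \<le> 1/2) \<and> 0 < \<delta> \<and> \<delta> \<le> 1/2 \<and> 0 \<le> K \<and>
    stabilizes_least_squares r G z \<delta> K"
proof -
  obtain G :: "('d \<Rightarrow> nat) set" and z :: "('d \<Rightarrow> nat) \<Rightarrow> real^'d" and \<delta> K where
    G: "finite G" "\<forall>\<beta>\<in>G. norm (z \<beta>) \<le> 1/2" "0 < \<delta>" "\<delta> \<le> 1/2" "0 \<le> K" and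
    grid: "\<And>\<theta> u. (\<forall>\<beta>\<in>G. u \<beta> \<in> ball (z \<beta>) \<delta>) \<Longrightarrow>
      (\<Sum>\<alpha>\<in>multi_indices r. \<bar>\<theta> \<alpha>\<bar>) \<le>
        K * (\<Sum>\<beta>\<in>G. \<bar>\<Sum>\<alpha>\<in>multi_indices r. \<theta> \<alpha> * multi_power (u \<beta>) \<alpha>\<bar>)"
    using grid_bounds_coefficients[of r, where 'd='d] by blast
  have main: "(\<Sum>\<alpha>\<in>multi_indices r. \<bar>\<theta> \<alpha>\<bar>) \<le>
        2 * (K * card G)\<^sup>2 / \<nu> * (\<Sum>\<alpha>\<in>multi_indices r. \<bar>\<Sum>i\<in>I. \<xi> i * multi_power (v i) \<alpha>\<bar>)"
    if I: "finite I" and nu: "\<nu> > 0" and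
      cells: "\<forall>\<beta>\<in>G. \<nu> \<le> real (card {i\<in>I. v i \<in> ball (z \<beta>) \<delta>})" and
      ls: "(\<Sum>i\<in>I. (\<Sum>\<alpha>\<in>multi_indices r. \<theta> \<alpha> * multi_power (v i) \<alpha>)\<^sup>2) \<le>
        2 * (\<Sum>i\<in>I. \<xi> i * (\<Sum>\<alpha>\<in>multi_indices r. \<theta> \<alpha> * multi_power (v i) \<alpha>))"
    for I :: "nat set" and v \<nu> \<xi> \<theta>
  proof -
    define P where "P = (\<lambda>x. \<Sum>\<alpha>\<in>multi_indices r. \<theta> \<alpha> * multi_power x \<alpha>)"
    define T where "T = (\<Sum>\<alpha>\<in>multi_indices r. \<bar>\<theta> \<alpha>\<bar>)"
    define Q where "Q = (\<Sum>i\<in>I. (P (v i))\<^sup>2)"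
    define R where "R = (\<Sum>\<alpha>\<in>multi_indices r. \<bar>\<Sum>i\<in>I. \<xi> i * multi_power (v i) \<alpha>\<bar>)"
    have T0: "T \<ge> 0" by (simp add: T_def sum_nonneg)
    have "\<exists>i. i \<in> I \<and> v i \<in> ball (z \<beta>) \<delta> \<and> \<bar>P (v i)\<bar> \<le> sqrt (Q / \<nu>)" if "\<beta> \<in> G" for \<beta>
    proof (rule ccontr)
      assume "\<not> ?thesis"
      then have big: "sqrt (Q / \<nu>) < \<bar>P (v i)\<bar>" if "i \<in> I" "v i \<in> ball (z \<beta>) \<delta>" for i
        using that by force
      define J where "J = {i\<in>I. v i \<in> ball (z \<beta>) \<delta>}"
      have cJ: "\<nu> \<le> card J" using cells that by (simp add: J_def)
      have Q0: "Q \<ge> 0" by (simp add: Q_def sum_nonneg)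
      have "Q / \<nu> < (P (v i))\<^sup>2" if "i \<in> J" for i
      proof -
        have "(sqrt (Q / \<nu>))\<^sup>2 < \<bar>P (v i)\<bar>\<^sup>2"
          using big that Q0 nu by (intro power_strict_mono) (auto simp: J_def)
        then show ?thesis using Q0 nu by simp
      qed
      moreover have "finite J" using I by (simp add: J_def)
      moreover have "J \<noteq> {}" using cJ nu by auto
      ultimately have "(\<Sum>i\<in>J. Q / \<nu>) < (\<Sum>i\<in>J. (P (v i))\<^sup>2)" by (intro sum_strict_mono) auto
      also have "\<dots> \<le> Q" unfolding Q_def using I by (intro sum_mono2) (auto simp: J_def)
      finally have "card J * (Q / \<nu>) < Q" by simp
      moreover have "\<nu> * (Q / \<nu>) \<le> card J * (Q / \<nu>)" using cJ Q0 nu by (intro mult_right_mono) auto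
      ultimately show False using nu by simp
    qed
    then obtain i where i: "\<And>\<beta>. \<beta> \<in> G \<Longrightarrow> v (i \<beta>) \<in> ball (z \<beta>) \<delta>"
      "\<And>\<beta>. \<beta> \<in> G \<Longrightarrow> \<bar>P (v (i \<beta>))\<bar> \<le> sqrt (Q / \<nu>)" by metis
    have "T \<le> K * (\<Sum>\<beta>\<in>G. \<bar>P (v (i \<beta>))\<bar>)"
      unfolding T_def P_def using i(1) by (intro grid) auto
    also have "\<dots> \<le> K * (\<Sum>\<beta>\<in>G. sqrt (Q / \<nu>))"
      using G(5) i(2) by (intro mult_left_mono sum_mono) auto
    finally have "T \<le> (K * card G) * sqrt (Q / \<nu>)" by simp
    then have "T\<^sup>2 \<le> ((K * card G) * sqrt (Q / \<nu>))\<^sup>2" using T0 by (intro power_mono) auto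
    also have "\<dots> = (K * card G)\<^sup>2 / \<nu> * Q"
      using nu by (simp add: power_mult_distrib Q_def sum_nonneg)
    also have "\<dots> \<le> (K * card G)\<^sup>2 / \<nu> * (2 * (\<Sum>i\<in>I. \<xi> i * P (v i)))"
      using ls nu unfolding Q_def P_def by (intro mult_left_mono) auto
    also have "\<dots> \<le> (K * card G)\<^sup>2 / \<nu> * (2 * (T * R))"
    proof -
      have "(\<Sum>i\<in>I. \<xi> i * P (v i)) = (\<Sum>i\<in>I. \<Sum>\<alpha>\<in>multi_indices r. \<theta> \<alpha> * (\<xi> i * multi_power (v i) \<alpha>))"
        unfolding P_def by (simp add: sum_distrib_left mult_ac)
      also have "\<dots> = (\<Sum>\<alpha>\<in>multi_indices r. \<theta> \<alpha> * (\<Sum>i\<in>I. \<xi> i * multi_power (v i) \<alpha>))"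
        by (subst sum.swap) (simp add: sum_distrib_left)
      also have "\<dots> \<le> (\<Sum>\<alpha>\<in>multi_indices r. \<bar>\<theta> \<alpha>\<bar> * R)"
      proof (rule sum_mono)
        fix \<alpha> :: "'d \<Rightarrow> nat" assume "\<alpha> \<in> multi_indices r"
        then have "\<bar>\<Sum>i\<in>I. \<xi> i * multi_power (v i) \<alpha>\<bar> \<le> R" unfolding R_def
          using finite_multi_indices
          by (intro member_le_sum[of \<alpha> "multi_indices r" "\<lambda>\<alpha>. \<bar>\<Sum>i\<in>I. \<xi> i * multi_power (v i) \<alpha>\<bar>"]) auto
        then show "\<theta> \<alpha> * (\<Sum>i\<in>I. \<xi> i * multi_power (v i) \<alpha>) \<le> \<bar>\<theta> \<alpha>\<bar> * R"
          by - (rule order.trans[OF abs_ge_self], simp add: abs_mult mult_left_mono)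
      qed
      also have "\<dots> = T * R" by (simp add: T_def sum_distrib_right)
      finally show ?thesis using nu by (intro mult_left_mono) auto
    qed
    finally have "T * T \<le> T * (2 * (K * card G)\<^sup>2 / \<nu> * R)"
      by (simp add: power2_eq_square mult_ac)
    moreover have "2 * (K * card G)\<^sup>2 / \<nu> * R \<ge> 0" using nu by (simp add: R_def sum_nonneg)
    ultimately have "T \<le> 2 * (K * card G)\<^sup>2 / \<nu> * R"
      using T0 mult_left_le_imp_le[of T T "2 * (K * card G)\<^sup>2 / \<nu> * R"] by (cases "T = 0") auto
    then show ?thesis unfolding T_def R_def .
  qed
  show ?thesis
  proof (intro exI conjI)
    show "finite G" "\<forall>\<beta>\<in>G. norm (z \<beta>) \<le> 1/2" "0 < \<delta>" "\<delta> \<le> 1/2"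
      using G by simp_all
    show "0 \<le> 2 * (K * card G)\<^sup>2" by simp
    show "stabilizes_least_squares r G z \<delta> (2 * (K * card G)\<^sup>2)"
      unfolding stabilizes_least_squares_def by (intro allI impI) (rule main)
  qed
qed

section \<open>Sums of independent random variables\<close>

lemma (in prob_space) second_moment_sum_indep_centered:
  fixes V :: "'i \<Rightarrow> 'a \<Rightarrow> real"
  assumes "finite I" "indep_vars (\<lambda>_. borel) V I"
    and "\<And>i. i \<in> I \<Longrightarrow> integrable M (\<lambda>s. (V i s)\<^sup>2)"
    and "\<And>i. i \<in> I \<Longrightarrow> expectation (V i) = 0"
  shows "integrable M (\<lambda>s. (\<Sum>i\<in>I. V i s)\<^sup>2) \<and>
    expectation (\<lambda>s. (\<Sum>i\<in>I. V i s)\<^sup>2) = (\<Sum>i\<in>I. expectation (\<lambda>s. (V i s)\<^sup>2))"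
  using assms
proof (induction I rule: finite_induct)
  case (insert i I)
  have rv: "V l \<in> borel_measurable M" if "l \<in> insert i I" for l
    using insert.prems(1) that by (auto simp: indep_vars_def)
  have int: "integrable M (V l)" if "l \<in> insert i I" for l
    by (rule square_integrable_imp_integrable[OF rv insert.prems(2)]) (use that in auto)
  have IH: "integrable M (\<lambda>s. (\<Sum>i\<in>I. V i s)\<^sup>2)"
    "expectation (\<lambda>s. (\<Sum>i\<in>I. V i s)\<^sup>2) = (\<Sum>i\<in>I. expectation (\<lambda>s. (V i s)\<^sup>2))"
    using insert.IH insert.prems indep_vars_subset[OF insert.prems(1), of I] by auto
  have ind: "indep_var borel (V i) borel (\<lambda>s. \<Sum>i\<in>I. V i s)"
    by (rule indep_vars_sum) (use insert in auto)
  have intS: "integrable M (\<lambda>s. \<Sum>i\<in>I. V i s)" using int by auto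
  have intVS: "integrable M (\<lambda>s. V i s * (\<Sum>i\<in>I. V i s))"
    by (rule indep_var_integrable[OF ind _ intS]) (use int in auto)
  have VS: "expectation (\<lambda>s. V i s * (\<Sum>i\<in>I. V i s)) = 0"
    using indep_var_lebesgue_integral[OF ind _ intS] int insert.prems(3)[of i] by simp
  have eq: "(\<Sum>l\<in>insert i I. V l s)\<^sup>2 = (V i s)\<^sup>2 + (2 * (V i s * (\<Sum>i\<in>I. V i s)) + (\<Sum>i\<in>I. V i s)\<^sup>2)" for s
    using insert.hyps by (simp add: power2_sum)
  have i1: "integrable M (\<lambda>s. (V i s)\<^sup>2)" using insert.prems(2) by auto
  show ?case
    unfolding eq using i1 intVS IH VS insert.hyps by simp
qed simp

text \<open>Chebyshev's inequality for the sum of the centered variables \<open>\<Phi> (Z i) - E \<Phi>\<close>: their variances add up,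
  and each is at most the second moment of \<open>\<Phi>\<close>.\<close>

lemma (in prob_space) iid_Chebyshev:
  fixes \<Phi> :: "'b::topological_space \<Rightarrow> real" and Z :: "nat \<Rightarrow> 'a \<Rightarrow> 'b"
  assumes indep: "indep_vars (\<lambda>_. borel) Z {1..n}"
    and same: "\<And>i. i \<in> {1..n} \<Longrightarrow> distr M borel (Z i) = Q"
    and [measurable]: "\<Phi> \<in> borel_measurable borel"
    and sq: "integrable Q (\<lambda>z. (\<Phi> z)\<^sup>2)" and bd: "(\<integral>z. (\<Phi> z)\<^sup>2 \<partial>Q) \<le> v" and t: "t > 0"
  shows "prob {s\<in>space M. t \<le> \<bar>(\<Sum>i\<in>{1..n}. \<Phi> (Z i s)) - real n * (\<integral>z. \<Phi> z \<partial>Q)\<bar>} \<le> real n * v / t\<^sup>2"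
proof (cases "n = 0")
  case True
  then show ?thesis using t by simp
next
  case False
  define \<mu> where "\<mu> = (\<integral>z. \<Phi> z \<partial>Q)"
  define V where "V = (\<lambda>i s. \<Phi> (Z i s) - \<mu>)"
  have Zm[measurable]: "Z i \<in> borel_measurable M" if "i \<in> {1..n}" for i
    using indep that unfolding indep_vars_def by auto
  have Q: "prob_space Q" 
    using same[of 1] Zm[of 1] prob_space_distr[of "Z 1" borel] False by auto
  then interpret Q: prob_space Q .
  have sQ: "sets Q = sets borel" using same[of 1] False by (metis atLeastAtMost_iff le_refl less_one not_le sets_distr)
  have mQ: "\<Phi> \<in> borel_measurable Q" using sQ by (simp cong: measurable_cong_sets)
  have intQ: "integrable Q \<Phi>"
    by (rule Q.square_integrable_imp_integrable[OF mQ sq])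
  have intQ2: "integrable Q (\<lambda>z. (\<Phi> z - \<mu>)\<^sup>2)"
    using intQ sq by (simp add: power2_diff)
  have varQ: "(\<integral>z. (\<Phi> z - \<mu>)\<^sup>2 \<partial>Q) \<le> v"
    using Q.variance_eq[OF intQ sq] bd unfolding \<mu>_def
    by (metis (no_types, lifting) diff_le_eq le_add_same_cancel1 order.trans zero_le_power2)
  have indV: "indep_vars (\<lambda>_. borel) V {1..n}"
    unfolding V_def by (rule indep_vars_compose2[OF indep, of "\<lambda>_ z. \<Phi> z - \<mu>"]) auto
  have tr: "integrable M (\<lambda>s. g (Z i s))" "expectation (\<lambda>s. g (Z i s)) = (\<integral>z. g z \<partial>Q)"
    if "i \<in> {1..n}" "g \<in> borel_measurable borel" "integrable Q g" for i and g :: "'b \<Rightarrow> real"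
  proof -
    show "integrable M (\<lambda>s. g (Z i s))"
      using that same[of i] Zm[of i] integrable_distr[of "Z i" M borel g] by auto
    show "expectation (\<lambda>s. g (Z i s)) = (\<integral>z. g z \<partial>Q)"
      using that same[of i] Zm[of i] integral_distr[of "Z i" M borel g] by auto
  qed
  have "integrable M (\<lambda>s. (\<Sum>i\<in>{1..n}. V i s)\<^sup>2) \<and>
    expectation (\<lambda>s. (\<Sum>i\<in>{1..n}. V i s)\<^sup>2) = (\<Sum>i\<in>{1..n}. expectation (\<lambda>s. (V i s)\<^sup>2))"
  proof (rule second_moment_sum_indep_centered[OF _ indV])
    fix i assume i: "i \<in> {1..n}"
    show "integrable M (\<lambda>s. (V i s)\<^sup>2)" unfolding V_def
      using tr(1)[of i "\<lambda>z. (\<Phi> z - \<mu>)\<^sup>2"] i intQ2 by simp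
    show "expectation (V i) = 0" unfolding V_def
      using tr(2)[of i "\<lambda>z. \<Phi> z - \<mu>"] i intQ by (simp add: \<mu>_def Q.prob_space)
  qed simp
  moreover have "expectation (\<lambda>s. (V i s)\<^sup>2) \<le> v" if "i \<in> {1..n}" for i
    unfolding V_def using tr(2)[of i "\<lambda>z. (\<Phi> z - \<mu>)\<^sup>2"] that intQ2 varQ by simp
  ultimately have sqS: "integrable M (\<lambda>s. (\<Sum>i\<in>{1..n}. V i s)\<^sup>2)"
    and bS: "expectation (\<lambda>s. (\<Sum>i\<in>{1..n}. V i s)\<^sup>2) \<le> real n * v"
    using sum_mono[of "{1..n}" "\<lambda>i. expectation (\<lambda>s. (V i s)\<^sup>2)" "\<lambda>_. v"] by auto
  have "prob {s\<in>space M. t \<le> \<bar>\<Sum>i\<in>{1..n}. V i s\<bar>} \<le> expectation (\<lambda>s. (\<Sum>i\<in>{1..n}. V i s)\<^sup>2) / t\<^sup>2"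
    by (rule second_moment_method[OF _ sqS t]) (simp add: V_def)
  also have "\<dots> \<le> real n * v / t\<^sup>2" using bS by (intro divide_right_mono) auto
  finally show ?thesis by (simp add: V_def sum_subtractf \<mu>_def)
qed

section \<open>Moments of the noise and density bounds\<close>

text \<open>The noise \<open>Y - f(X)\<close> may fail to be integrable, because only the conditional second moment of \<open>Y\<close> is
  almost surely finite. Multiplied by a function of \<open>X\<close> supported in a ball it is square integrable: the conditional
  variance of a coordinate is a diagonal entry of the conditional covariance matrix, hence at most its
  operator norm. It is then centered because \<open>f(X)\<close>, bounded on the ball, is the conditional mean.\<close>

lemma truncated_noise_moments:
  fixes f :: "real^'d::finite \<Rightarrow> real^'D::finite" and X :: "'w \<Rightarrow> real^'d" and w :: "real^'d \<Rightarrow> real"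
  assumes "prob_space M" and X: "X \<in> borel_measurable M" and Y: "Y \<in> borel_measurable M"
    and fin: "cond_second_moment_finite M X Y"
    and mean: "AE w in M. f (X w) = cond_mean M X Y w"
    and cov: "AE w in M. onorm ((*v) (cond_cov M X Y w)) \<le> \<sigma>"
    and f: "continuous_on UNIV f" and w: "w \<in> borel_measurable borel"
    and wb: "\<And>u. \<bar>w u\<bar> \<le> indicator (cball 0 h) u"
  shows "integrable M (\<lambda>\<omega>. ((Y \<omega> $ j - f (X \<omega>) $ j) * w (X \<omega>))\<^sup>2)"
    and "(\<integral>\<omega>. ((Y \<omega> $ j - f (X \<omega>) $ j) * w (X \<omega>))\<^sup>2 \<partial>M) \<le> \<sigma> * measure M (X -` cball 0 h \<inter> space M)"
    and "(\<integral>\<omega>. (Y \<omega> $ j - f (X \<omega>) $ j) * w (X \<omega>) \<partial>M) = 0"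
proof -
  interpret prob_space M by fact
  define F where "F = sigma_gen M X"
  have "subalgebra M F"
    unfolding subalgebra_def F_def using X by (auto simp: sets_vimage_algebra2 measurable_sets)
  then interpret finite_measure_subalgebra M F
    by unfold_locales
  have XF: "X \<in> borel_measurable F" unfolding F_def by (rule measurable_vimage_algebra1) auto
  note [measurable] = X Y w XF
  have fm[measurable]: "f \<in> borel_measurable borel" by (rule borel_measurable_continuous_onI[OF f])
  have Yj[measurable]: "(\<lambda>\<omega>. Y \<omega> $ j) \<in> borel_measurable M"
    by (rule measurable_compose[OF Y]) (intro borel_measurable_continuous_onI continuous_intros)
  have fj[measurable]: "(\<lambda>\<omega>. f (X \<omega>) $ j) \<in> borel_measurable M"
    by (rule measurable_compose[OF measurable_compose[OF X fm]]) (intro borel_measurable_continuous_onI continuous_intros)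
  have wF: "(\<lambda>\<omega>. w (X \<omega>)) \<in> borel_measurable F" by measurable
  define cm where "cm = real_cond_exp M F (\<lambda>v. Y v $ j)"
  have cmF[measurable]: "cm \<in> borel_measurable F" unfolding cm_def by simp
  have cmM[measurable]: "cm \<in> borel_measurable M" unfolding cm_def by simp
  have cm: "AE \<omega> in M. f (X \<omega>) $ j = cm \<omega>"
    using mean by eventually_elim (simp add: cond_mean_def cm_def F_def)
  define g where "g = (\<lambda>\<omega>. ennreal ((Y \<omega> $ j - cm \<omega>)\<^sup>2))"
  have gM[measurable]: "g \<in> borel_measurable M" unfolding g_def by measurable
  \<comment> \<open>Without this finiteness, the real-valued conditional expectation in the
    covariance could be zero where the true conditional variance is infinite.\<close>
  have gfin: "AE \<omega> in M. nn_cond_exp M F g \<omega> < \<infinity>"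
  proof -
    have 1: "AE \<omega> in M. nn_cond_exp M F g \<omega> \<le> nn_cond_exp M F (\<lambda>\<omega>. 2 * ennreal ((norm (Y \<omega>))\<^sup>2) + ennreal (2 * (cm \<omega>)\<^sup>2)) \<omega>"
    proof (rule nn_cond_exp_mono)
      show "AE \<omega> in M. g \<omega> \<le> 2 * ennreal ((norm (Y \<omega>))\<^sup>2) + ennreal (2 * (cm \<omega>)\<^sup>2)"
      proof (intro AE_I2)
        fix \<omega>
        have "(Y \<omega> $ j)\<^sup>2 \<le> (norm (Y \<omega>))\<^sup>2"
          using component_le_norm_cart[of "Y \<omega>" j] by (metis abs_le_square_iff abs_norm_cancel)
        moreover have "(Y \<omega> $ j - cm \<omega>)\<^sup>2 \<le> 2 * (Y \<omega> $ j)\<^sup>2 + 2 * (cm \<omega>)\<^sup>2"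
          using zero_le_power2[of "Y \<omega> $ j + cm \<omega>"] by (simp add: power2_sum power2_diff)
        ultimately have "(Y \<omega> $ j - cm \<omega>)\<^sup>2 \<le> 2 * (norm (Y \<omega>))\<^sup>2 + 2 * (cm \<omega>)\<^sup>2" by linarith
        then have "g \<omega> \<le> ennreal (2 * (norm (Y \<omega>))\<^sup>2 + 2 * (cm \<omega>)\<^sup>2)"
          unfolding g_def by (rule ennreal_leI)
        also have "\<dots> = 2 * ennreal ((norm (Y \<omega>))\<^sup>2) + ennreal (2 * (cm \<omega>)\<^sup>2)"
          by (simp add: ennreal_plus ennreal_mult)
        finally show "g \<omega> \<le> 2 * ennreal ((norm (Y \<omega>))\<^sup>2) + ennreal (2 * (cm \<omega>)\<^sup>2)" .
      qed
    qed measurable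
    have 2: "AE \<omega> in M. nn_cond_exp M F (\<lambda>\<omega>. 2 * ennreal ((norm (Y \<omega>))\<^sup>2)) \<omega> + nn_cond_exp M F (\<lambda>\<omega>. ennreal (2 * (cm \<omega>)\<^sup>2)) \<omega>
       = nn_cond_exp M F (\<lambda>\<omega>. 2 * ennreal ((norm (Y \<omega>))\<^sup>2) + ennreal (2 * (cm \<omega>)\<^sup>2)) \<omega>"
      by (rule nn_cond_exp_sum) measurable
    have 3: "AE \<omega> in M. 2 * nn_cond_exp M F (\<lambda>\<omega>. ennreal ((norm (Y \<omega>))\<^sup>2)) \<omega> = nn_cond_exp M F (\<lambda>\<omega>. 2 * ennreal ((norm (Y \<omega>))\<^sup>2)) \<omega>"
      by (rule nn_cond_exp_prod) measurable
    have 4: "AE \<omega> in M. ennreal (2 * (cm \<omega>)\<^sup>2) = nn_cond_exp M F (\<lambda>\<omega>. ennreal (2 * (cm \<omega>)\<^sup>2)) \<omega>"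
      by (rule nn_cond_exp_F_meas) measurable
    have 5: "AE \<omega> in M. nn_cond_exp M F (\<lambda>\<omega>. ennreal ((norm (Y \<omega>))\<^sup>2)) \<omega> < \<infinity>"
      using fin unfolding cond_second_moment_finite_def F_def .
    show ?thesis
      using 1 2 3 4 5
    proof eventually_elim
      case (elim \<omega>)
      then have "nn_cond_exp M F g \<omega> \<le> 2 * nn_cond_exp M F (\<lambda>\<omega>. ennreal ((norm (Y \<omega>))\<^sup>2)) \<omega> + ennreal (2 * (cm \<omega>)\<^sup>2)"
        by metis
      also have "\<dots> < \<infinity>" using elim(5) by (auto simp: ennreal_mult_less_top)
      finally show ?case .
    qed
  qed
  have zero: "AE \<omega> in M. nn_cond_exp M F (\<lambda>v. 0) \<omega> = 0"
    using nn_cond_exp_F_meas[of "\<lambda>_. 0"] by (rule eventually_mono) (auto dest: sym)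
  have gle: "AE \<omega> in M. nn_cond_exp M F g \<omega> \<le> ennreal \<sigma>"
    using gfin cov zero
  proof eventually_elim
    case (elim \<omega>)
    have eq: "(\<lambda>v. ennreal (- ((Y v $ j - cm v) * (Y v $ j - cm v)))) = (\<lambda>v. 0)"
      by (simp add: ennreal_neg)
    have "cond_cov M X Y \<omega> $ j $ j = real_cond_exp M F (\<lambda>v. (Y v $ j - cm v) * (Y v $ j - cm v)) \<omega>"
      by (simp add: cond_cov_def cond_mean_def F_def cm_def)
    also have "\<dots> = enn2real (nn_cond_exp M F g \<omega>)"
      unfolding real_cond_exp_def eq using elim(3) by (simp add: g_def power2_eq_square)
    finally have "enn2real (nn_cond_exp M F g \<omega>) \<le> \<sigma>"
      using matrix_component_le_onorm[of "cond_cov M X Y \<omega>" j j] elim(2) by linarith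
    then have "ennreal (enn2real (nn_cond_exp M F g \<omega>)) \<le> ennreal \<sigma>" by (rule ennreal_leI)
    then show ?case using elim(1) by simp
  qed
  have "AE \<omega> in M. 0 \<le> \<sigma>"
    using cov
  proof eventually_elim
    case (elim \<omega>)
    then show ?case
      using onorm_pos_le[OF matrix_vector_mul_bounded_linear, of "cond_cov M X Y \<omega>"] by linarith
  qed
  then have sigma0: "0 \<le> \<sigma>" by simp
  define V where "V = (\<lambda>\<omega>. (Y \<omega> $ j - f (X \<omega>) $ j) * w (X \<omega>))"
  define A where "A = X -` cball 0 h \<inter> space M"
  have A[measurable]: "A \<in> sets M" unfolding A_def using X by (rule measurable_sets) simp
  have Vm[measurable]: "V \<in> borel_measurable M" unfolding V_def by measurable
  have w2: "ennreal ((w (X \<omega>))\<^sup>2) \<le> indicator A \<omega>" if "\<omega> \<in> space M" for \<omega>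
  proof -
    have "(w (X \<omega>))\<^sup>2 \<le> (indicator (cball 0 h) (X \<omega>))\<^sup>2"
      using wb[of "X \<omega>"] by (metis abs_ge_zero power2_abs power_mono)
    also have "\<dots> = indicator A \<omega>" using that by (auto simp: A_def indicator_def)
    finally have "ennreal ((w (X \<omega>))\<^sup>2) \<le> ennreal (indicator A \<omega>)" by (rule ennreal_leI)
    then show ?thesis by (simp add: ennreal_indicator)
  qed
  have "(\<integral>\<^sup>+\<omega>. ennreal ((V \<omega>)\<^sup>2) \<partial>M) = (\<integral>\<^sup>+\<omega>. ennreal ((w (X \<omega>))\<^sup>2) * g \<omega> \<partial>M)"
    using cm by (intro nn_integral_cong_AE, eventually_elim)
      (simp add: V_def g_def power_mult_distrib mult.commute flip: ennreal_mult)
  also have "\<dots> = (\<integral>\<^sup>+\<omega>. ennreal ((w (X \<omega>))\<^sup>2) * nn_cond_exp M F g \<omega> \<partial>M)"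
    using wF by (intro nn_cond_exp_intg[symmetric] gM) measurable
  also have "\<dots> \<le> (\<integral>\<^sup>+\<omega>. ennreal \<sigma> * indicator A \<omega> \<partial>M)"
  proof (rule nn_integral_mono_AE)
    show "AE \<omega> in M. ennreal ((w (X \<omega>))\<^sup>2) * nn_cond_exp M F g \<omega> \<le> ennreal \<sigma> * indicator A \<omega>"
      using gle AE_space
    proof eventually_elim
      case (elim \<omega>)
      then show ?case using mult_mono[OF w2[of \<omega>] elim(1)] by (simp add: mult.commute)
    qed
  qed
  also have "\<dots> = ennreal (\<sigma> * measure M A)"
    using sigma0 by (simp add: nn_integral_cmult_indicator emeasure_eq_measure ennreal_mult)
  finally have nn: "(\<integral>\<^sup>+\<omega>. ennreal ((V \<omega>)\<^sup>2) \<partial>M) \<le> ennreal (\<sigma> * measure M A)" .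
  have sqV: "integrable M (\<lambda>\<omega>. (V \<omega>)\<^sup>2)"
    using nn by (intro integrableI_bounded) (auto intro: le_less_trans)
  then show "integrable M (\<lambda>\<omega>. ((Y \<omega> $ j - f (X \<omega>) $ j) * w (X \<omega>))\<^sup>2)"
    by (simp add: V_def)
  have "(\<integral>\<omega>. (V \<omega>)\<^sup>2 \<partial>M) \<le> \<sigma> * measure M A"
    using nn sigma0 by (intro integral_real_bounded) auto
  then show "(\<integral>\<omega>. ((Y \<omega> $ j - f (X \<omega>) $ j) * w (X \<omega>))\<^sup>2 \<partial>M) \<le> \<sigma> * measure M (X -` cball 0 h \<inter> space M)"
    by (simp add: V_def A_def)
  have intV: "integrable M V"
    by (rule square_integrable_imp_integrable[OF Vm sqV])
  have "compact (f ` cball 0 h)"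
    using f by (intro compact_continuous_image) (auto intro: continuous_on_subset)
  then obtain B where B: "\<And>u. u \<in> cball 0 h \<Longrightarrow> norm (f u) \<le> B"
    using compact_imp_bounded bounded_iff by (metis imageI)
  have wfb: "\<bar>w u * f u $ j\<bar> \<le> max B 0" for u
  proof (cases "u \<in> cball 0 h")
    case True
    then have "\<bar>w u\<bar> * \<bar>f u $ j\<bar> \<le> 1 * B"
      using wb[of u] B[OF True] component_le_norm_cart[of "f u" j] by (intro mult_mono) auto
    then show ?thesis by (simp add: abs_mult)
  next
    case False
    then show ?thesis using wb[of u] by simp
  qed
  have intwf: "integrable M (\<lambda>\<omega>. w (X \<omega>) * f (X \<omega>) $ j)"
    using wfb by (intro integrable_const_bound[where B = "max B 0"]) auto
  have intwY: "integrable M (\<lambda>\<omega>. w (X \<omega>) * Y \<omega> $ j)"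
    using Bochner_Integration.integrable_add[OF intV intwf] by (simp add: V_def algebra_simps)
  have "(\<integral>\<omega>. w (X \<omega>) * f (X \<omega>) $ j \<partial>M) = (\<integral>\<omega>. w (X \<omega>) * cm \<omega> \<partial>M)"
    using cm by (intro integral_cong_AE) (auto elim: eventually_mono)
  also have "\<dots> = (\<integral>\<omega>. w (X \<omega>) * Y \<omega> $ j \<partial>M)"
    unfolding cm_def using intwY wF Yj by (rule real_cond_exp_intg(2))
  finally show "(\<integral>\<omega>. (Y \<omega> $ j - f (X \<omega>) $ j) * w (X \<omega>) \<partial>M) = 0"
    using Bochner_Integration.integral_diff[OF intwY intwf] by (simp add: algebra_simps)
qed

lemma distributed_measure_bounds:
  fixes X :: "'w \<Rightarrow> real^'d::finite"
  assumes "prob_space M" and X: "distributed M lborel X p"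
    and p: "\<And>u. u \<in> B \<Longrightarrow> ennreal a \<le> p u \<and> p u \<le> ennreal b" and a: "a > 0" and B: "B \<in> sets borel"
    and fin: "emeasure lborel B < \<infinity>" and ne: "B \<noteq> {}"
  shows "a * measure lborel B \<le> measure M (X -` B \<inter> space M)"
    and "measure M (X -` B \<inter> space M) \<le> b * measure lborel B"
proof -
  interpret prob_space M by fact
  have eq: "emeasure M (X -` B \<inter> space M) = (\<integral>\<^sup>+u. p u * indicator B u \<partial>lborel)"
    by (rule distributed_emeasure[OF X]) (use B in simp)
  have b: "b \<ge> 0"
  proof -
    obtain u where "u \<in> B" using ne by auto
    then have "ennreal a \<le> ennreal b" using p order.trans by blast
    then show ?thesis using a by (metis ennreal_le_iff2 less_le_not_le linorder_le_cases order_less_le_trans)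
  qed
  have "ennreal (a * measure lborel B) = (\<integral>\<^sup>+u. ennreal a * indicator B u \<partial>lborel)"
    using a B fin by (simp add: nn_integral_cmult_indicator emeasure_eq_ennreal_measure ennreal_mult less_top)
  also have "\<dots> \<le> (\<integral>\<^sup>+u. p u * indicator B u \<partial>lborel)"
    using p by (intro nn_integral_mono) (auto simp: indicator_def)
  also have "\<dots> = ennreal (measure M (X -` B \<inter> space M))" unfolding eq[symmetric] by (rule emeasure_eq_measure)
  finally show "a * measure lborel B \<le> measure M (X -` B \<inter> space M)" by simp
  have "ennreal (measure M (X -` B \<inter> space M)) = (\<integral>\<^sup>+u. p u * indicator B u \<partial>lborel)"
    unfolding eq[symmetric] by (rule emeasure_eq_measure[symmetric])
  also have "\<dots> \<le> (\<integral>\<^sup>+u. ennreal b * indicator B u \<partial>lborel)"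
    using p by (intro nn_integral_mono) (auto simp: indicator_def)
  also have "\<dots> = ennreal (b * measure lborel B)"
    using b B fin by (simp add: nn_integral_cmult_indicator emeasure_eq_ennreal_measure ennreal_mult less_top)
  finally show "measure M (X -` B \<inter> space M) \<le> b * measure lborel B"
    using b by simp
qed

section \<open>Deviations in the sample\<close>

lemma count_Chebyshev:
  fixes X :: "'w \<Rightarrow> real^'d::finite" and Y :: "'w \<Rightarrow> real^'D::finite"
  assumes "prob_space M" and X[measurable]: "X \<in> borel_measurable M" and Y[measurable]: "Y \<in> borel_measurable M"
    and iid: "iid_sample M X Y n S x y" and B[measurable]: "B \<in> sets borel" and t: "t > 0"
  defines "q \<equiv> measure M (X -` B \<inter> space M)"
  defines "E \<equiv> {s\<in>space S. t \<le> \<bar>real (card {i\<in>{1..n}. x i s \<in> B}) - real n * q\<bar>}"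
  shows "E \<in> sets S" and "measure S E \<le> real n * q / t\<^sup>2"
proof -
  interpret M: prob_space M by fact
  interpret S: prob_space S using iid by (simp add: iid_sample_def)
  define \<Phi> :: "(real^'d) \<times> (real^'D) \<Rightarrow> real" where "\<Phi> = (\<lambda>z. indicator B (fst z))"
  have fstm[measurable]: "fst \<in> borel_measurable (borel :: ((real^'d) \<times> (real^'D)) measure)"
    by (intro borel_measurable_continuous_onI continuous_intros)
  have Pm[measurable]: "\<Phi> \<in> borel_measurable borel" unfolding \<Phi>_def by measurable
  have Zm: "(\<lambda>s. (x i s, y i s)) \<in> borel_measurable S" if "i \<in> {1..n}" for i
    using iid that unfolding iid_sample_def S.indep_vars_def by auto
  define Q where "Q = distr M borel (\<lambda>w. (X w, Y w))"
  have sq: "(\<lambda>z. (\<Phi> z)\<^sup>2) = \<Phi>" by (auto simp: \<Phi>_def indicator_def)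
  have comp: "(\<lambda>w. \<Phi> (X w, Y w)) = (\<lambda>w. indicator B (X w))" by (simp add: \<Phi>_def)
  have indi: "(\<integral>w. indicator B (X w) \<partial>M) = q"
  proof -
    have "(\<integral>w. indicator B (X w) \<partial>M) = (\<integral>w. indicator (X -` B \<inter> space M) w \<partial>M :: real)"
      by (intro Bochner_Integration.integral_cong) (auto simp: indicator_def)
    then show ?thesis by (simp add: q_def)
  qed
  have intPhi: "integrable Q \<Phi>" "(\<integral>z. \<Phi> z \<partial>Q) = q"
    unfolding Q_def using indi
    by (auto simp: integrable_distr_eq integral_distr comp intro!: M.integrable_const_bound[where B = 1])
  have eqE: "E = {s\<in>space S. t \<le> \<bar>(\<Sum>i\<in>{1..n}. \<Phi> (x i s, y i s)) - real n * (\<integral>z. \<Phi> z \<partial>Q)\<bar>}"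
  proof -
    have "real (card {i\<in>{1..n}. x i s \<in> B}) = (\<Sum>i\<in>{1..n}. \<Phi> (x i s, y i s))" for s
      by (simp add: \<Phi>_def indicator_def sum.If_cases Int_def)
    then show ?thesis unfolding E_def intPhi by simp
  qed
  show "measure S E \<le> real n * q / t\<^sup>2"
    unfolding eqE
  proof (rule S.iid_Chebyshev[OF _ _ Pm _ _ t])
    show "S.indep_vars (\<lambda>_. borel) (\<lambda>i s. (x i s, y i s)) {1..n}"
      using iid by (simp add: iid_sample_def)
    show "distr S borel (\<lambda>s. (x i s, y i s)) = Q" if "i \<in> {1..n}" for i
      using iid that by (simp add: iid_sample_def Q_def)
  qed (simp_all add: sq intPhi)
  show "E \<in> sets S"
    unfolding eqE using measurable_compose[OF Zm Pm] by measurable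
qed

lemma noise_Chebyshev:
  fixes f :: "real^'d::finite \<Rightarrow> real^'D::finite" and X :: "'w \<Rightarrow> real^'d" and w :: "real^'d \<Rightarrow> real" and j :: 'D
  assumes M: "prob_space M" and X[measurable]: "X \<in> borel_measurable M" and Y[measurable]: "Y \<in> borel_measurable M"
    and iid: "iid_sample M X Y n S x y" and t: "t > 0"
    and fin: "cond_second_moment_finite M X Y"
    and mean: "AE w in M. f (X w) = cond_mean M X Y w"
    and cov: "AE w in M. onorm ((*v) (cond_cov M X Y w)) \<le> \<sigma>"
    and f: "continuous_on UNIV f" and w[measurable]: "w \<in> borel_measurable borel"
    and wb: "\<And>u. \<bar>w u\<bar> \<le> indicator (cball 0 h) u"
  defines "E \<equiv> {s\<in>space S. t \<le> \<bar>\<Sum>i\<in>{1..n}. (y i s $ j - f (x i s) $ j) * w (x i s)\<bar>}"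
  shows "E \<in> sets S" and "measure S E \<le> real n * (\<sigma> * measure M (X -` cball 0 h \<inter> space M)) / t\<^sup>2"
proof -
  interpret M: prob_space M by fact
  interpret S: prob_space S using iid by (simp add: iid_sample_def)
  define \<Phi> :: "(real^'d) \<times> (real^'D) \<Rightarrow> real" where "\<Phi> = (\<lambda>z. (snd z $ j - f (fst z) $ j) * w (fst z))"
  have fstm[measurable]: "fst \<in> borel_measurable (borel :: ((real^'d) \<times> (real^'D)) measure)"
    by (intro borel_measurable_continuous_onI continuous_intros)
  have sndm[measurable]: "(\<lambda>z. snd z $ j) \<in> borel_measurable (borel :: ((real^'d) \<times> (real^'D)) measure)"
    by (intro borel_measurable_continuous_onI continuous_intros)
  have fm[measurable]: "(\<lambda>u. f u $ j) \<in> borel_measurable borel"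
    by (intro borel_measurable_continuous_onI continuous_intros f)
  have Pm[measurable]: "\<Phi> \<in> borel_measurable borel" unfolding \<Phi>_def by measurable
  have Zm: "(\<lambda>s. (x i s, y i s)) \<in> borel_measurable S" if "i \<in> {1..n}" for i
    using iid that unfolding iid_sample_def S.indep_vars_def by auto
  define Q where "Q = distr M borel (\<lambda>w. (X w, Y w))"
  note mom = truncated_noise_moments[OF M X Y fin mean cov f w wb, of j]
  have intsq: "integrable Q (\<lambda>z. (\<Phi> z)\<^sup>2)"
    "(\<integral>z. (\<Phi> z)\<^sup>2 \<partial>Q) \<le> \<sigma> * measure M (X -` cball 0 h \<inter> space M)"
    "(\<integral>z. \<Phi> z \<partial>Q) = 0"
    unfolding Q_def using mom
    by (simp_all add: integrable_distr_eq integral_distr) (simp_all add: \<Phi>_def)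
  have eqE: "E = {s\<in>space S. t \<le> \<bar>(\<Sum>i\<in>{1..n}. \<Phi> (x i s, y i s)) - real n * (\<integral>z. \<Phi> z \<partial>Q)\<bar>}"
    unfolding intsq(3) E_def by (simp add: \<Phi>_def)
  show "measure S E \<le> real n * (\<sigma> * measure M (X -` cball 0 h \<inter> space M)) / t\<^sup>2"
    unfolding eqE
  proof (rule S.iid_Chebyshev[OF _ _ Pm intsq(1,2) t])
    show "S.indep_vars (\<lambda>_. borel) (\<lambda>i s. (x i s, y i s)) {1..n}"
      using iid by (simp add: iid_sample_def)
    show "distr S borel (\<lambda>s. (x i s, y i s)) = Q" if "i \<in> {1..n}" for i
      using iid that by (simp add: iid_sample_def Q_def)
  qed
  show "E \<in> sets S"
    unfolding eqE using measurable_compose[OF Zm Pm] by measurable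
qed

section \<open>Error of the regressor on a good sample\<close>

text \<open>The squared Euclidean loss is the sum of the losses of the coordinates. Exchanging the \<open>j\<close>-th
  coordinate of the minimizer for another polynomial therefore compares the losses of that coordinate
  alone.\<close>

lemma local_poly_regressor_coordinatewise:
  fixes q :: "real^'d::finite \<Rightarrow> real^'D::finite"
  assumes reg: "local_poly_regressor r n h x y q"
  shows "(\<Sum>i\<in>local_indices n h x. (y i $ j - q (x i) $ j)\<^sup>2) \<le>
    (\<Sum>i\<in>local_indices n h x. (y i $ j - (\<Sum>\<alpha>\<in>multi_indices r. b \<alpha> * multi_power (x i) \<alpha>))\<^sup>2)"
proof (cases "local_indices n h x = {}")
  case False
  define I where "I = local_indices n h x"
  define P where "P = (\<lambda>x. \<Sum>\<alpha>\<in>multi_indices r. b \<alpha> * multi_power x \<alpha>)"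
  define q' :: "real^'d \<Rightarrow> real^'D" where "q' = (\<lambda>x. \<chi> l. if l = j then P x else q x $ l)"
  have q: "q \<in> poly_maps r" and min: "\<And>g. g \<in> poly_maps r \<Longrightarrow> \<not> local_loss n h x y g < local_loss n h x y q"
    using reg unfolding local_poly_regressor_def is_arg_min_def by auto
  have "q' \<in> poly_maps r"
    unfolding poly_maps_def
  proof (intro CollectI allI)
    fix l
    show "\<exists>b. \<forall>x. q' x $ l = (\<Sum>\<alpha>\<in>multi_indices r. b \<alpha> * (\<Prod>i\<in>UNIV. x $ i ^ \<alpha> i))"
      using q unfolding poly_maps_def
      by (cases "l = j") (auto simp: q'_def P_def multi_power_def)
  qed
  from min[OF this] have "local_loss n h x y q \<le> local_loss n h x y q'" by simp
  moreover have fI: "finite I" by (auto simp: I_def local_indices_def)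
  ultimately have le: "(\<Sum>i\<in>I. (norm (y i - q (x i)))\<^sup>2) \<le> (\<Sum>i\<in>I. (norm (y i - q' (x i)))\<^sup>2)"
    using False by (simp add: local_loss_def I_def[symmetric] divide_le_cancel card_gt_0_iff)
  have nsq: "(norm v)\<^sup>2 = (v $ j)\<^sup>2 + (\<Sum>l\<in>UNIV - {j}. (v $ l)\<^sup>2)" for v :: "real^'D"
    unfolding power2_norm_eq_inner inner_vec_def
    by (subst sum.remove[of UNIV j]) (auto simp: power2_eq_square)
  have "(\<Sum>l\<in>UNIV - {j}. ((y i - q' (x i)) $ l)\<^sup>2) = (\<Sum>l\<in>UNIV - {j}. ((y i - q (x i)) $ l)\<^sup>2)" for i
    by (intro sum.cong) (auto simp: q'_def)
  moreover have "(y i - q' (x i)) $ j = y i $ j - P (x i)" for i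
    by (simp add: q'_def)
  ultimately show ?thesis
    using le unfolding nsq sum.distrib I_def[symmetric] P_def by simp
qed simp

lemma multi_power_scaleR: "multi_power (c *\<^sub>R x) \<alpha> = c ^ (\<Sum>i\<in>UNIV. \<alpha> i) * multi_power x \<alpha>"
  by (simp add: multi_power_def power_mult_distrib prod.distrib power_sum)

lemma abs_multi_power_le_1: "norm x \<le> 1 \<Longrightarrow> \<bar>multi_power x \<alpha>\<bar> \<le> 1"
  unfolding multi_power_def abs_prod
  by (intro prod_le_1) (auto simp: power_abs intro!: power_le_one order.trans[OF component_le_norm_cart])

text \<open>The deterministic core, in the rescaled coordinates \<open>v = x/h\<close>, for one coordinate of the regressor.
  Compare it with a polynomial \<open>P\<close> with coefficients \<open>c\<close> (in the application, the Taylor polynomial of \<open>g\<close>). The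
  residuals of \<open>P\<close> split into noise \<open>y - g(x)\<close> and bias \<open>g(x) - P(x)\<close>; their correlations with the
  monomials are at most \<open>t\<close> and \<open>e * N\<close>, and stability turns them into a bound for the coefficients of
  the difference. The factor \<open>h\<^sup>|\<^sup>\<alpha>\<^sup>|\<close> comes from the rescaling.\<close>

lemma regressor_coefficient_bound:
  fixes q :: "real^'d::finite \<Rightarrow> real^'D::finite" and z :: "('d \<Rightarrow> nat) \<Rightarrow> real^'d"
  assumes h: "h > 0" and nu: "\<nu> > 0"
    and reg: "local_poly_regressor r n h x y q"
    and z: "\<forall>\<beta>\<in>G. norm (z \<beta>) \<le> 1/2" and d: "\<delta> \<le> 1/2" and K: "0 \<le> K"
    and ls: "stabilizes_least_squares r G z \<delta> K"
    and cells: "\<And>\<beta>. \<beta> \<in> G \<Longrightarrow> \<nu> \<le> real (card {i\<in>{1..n}. x i \<in> ball (h *\<^sub>R z \<beta>) (h * \<delta>)})"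
    and count: "real (card {i\<in>{1..n}. x i \<in> cball 0 h}) \<le> N"
    and noise: "\<And>\<alpha>. \<alpha> \<in> multi_indices r \<Longrightarrow>
      \<bar>\<Sum>i\<in>{1..n}. (y i $ j - g (x i)) * (multi_power ((1/h) *\<^sub>R x i) \<alpha> * indicator (cball 0 h) (x i))\<bar> \<le> t"
    and bias: "\<And>u. norm u \<le> h \<Longrightarrow>
      \<bar>g u - (\<Sum>\<alpha>\<in>multi_indices r. c \<alpha> * multi_power u \<alpha>)\<bar> \<le> e"
  shows "\<exists>b. (\<forall>u. q u $ j = (\<Sum>\<alpha>\<in>multi_indices r. b \<alpha> * multi_power u \<alpha>)) \<and>
    (\<Sum>\<alpha>\<in>multi_indices r. \<bar>b \<alpha> - c \<alpha>\<bar> * h ^ (\<Sum>i\<in>UNIV. \<alpha> i)) \<le>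
      K / \<nu> * (real (card (multi_indices r :: ('d \<Rightarrow> nat) set)) * (t + e * N))"
proof -
  define I where "I = local_indices n h x"
  have I_eq: "I = {i\<in>{1..n}. x i \<in> cball 0 h}" by (auto simp: I_def local_indices_def)
  have fI: "finite I" by (simp add: I_eq)
  have e0: "e \<ge> 0" using bias[of 0] h by (auto intro: order.trans[OF abs_ge_zero])
  obtain b where b: "\<And>u. q u $ j = (\<Sum>\<alpha>\<in>multi_indices r. b \<alpha> * multi_power u \<alpha>)"
    using reg unfolding local_poly_regressor_def is_arg_min_def poly_maps_def multi_power_def by blast
  define v where "v = (\<lambda>i. (1/h) *\<^sub>R x i)"
  define \<theta> where "\<theta> = (\<lambda>\<alpha>::'d\<Rightarrow>nat. (b \<alpha> - c \<alpha>) * h ^ (\<Sum>i\<in>UNIV. \<alpha> i))"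
  define P where "P = (\<lambda>u. \<Sum>\<alpha>\<in>multi_indices r. c \<alpha> * multi_power u \<alpha>)"
  define \<xi> where "\<xi> = (\<lambda>i. y i $ j - P (x i))"
  have xv: "x i = h *\<^sub>R v i" for i using h by (simp add: v_def)
  have Delta: "(\<Sum>\<alpha>\<in>multi_indices r. \<theta> \<alpha> * multi_power (v i) \<alpha>) = q (x i) $ j - P (x i)" for i
    unfolding b P_def xv multi_power_scaleR \<theta>_def
    by (simp add: sum_subtractf[symmetric] algebra_simps)
  have cells': "\<forall>\<beta>\<in>G. \<nu> \<le> real (card {i\<in>I. v i \<in> ball (z \<beta>) \<delta>})"
  proof
    fix \<beta> assume be: "\<beta> \<in> G"
    have "{i\<in>{1..n}. x i \<in> ball (h *\<^sub>R z \<beta>) (h * \<delta>)} \<subseteq> {i\<in>I. v i \<in> ball (z \<beta>) \<delta>}"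
    proof safe
      fix i assume i: "i \<in> {1..n}" "x i \<in> ball (h *\<^sub>R z \<beta>) (h * \<delta>)"
      have "dist (h *\<^sub>R z \<beta>) (x i) = h * dist (z \<beta>) (v i)"
        using h by (simp add: xv dist_norm flip: scaleR_diff_right)
      then have dv: "dist (z \<beta>) (v i) < \<delta>" using i h by simp
      then show "v i \<in> ball (z \<beta>) \<delta>" by simp
      have "norm (v i) \<le> norm (z \<beta>) + dist (z \<beta>) (v i)"
        by (metis dist_0_norm dist_triangle)
      then have "norm (v i) \<le> 1" using dv z be d by force
      then have "h * norm (v i) \<le> h * 1" using h by (intro mult_left_mono) auto
      then show "i \<in> I" using i h by (simp add: I_eq xv)
    qed
    then have "card {i\<in>{1..n}. x i \<in> ball (h *\<^sub>R z \<beta>) (h * \<delta>)} \<le> card {i\<in>I. v i \<in> ball (z \<beta>) \<delta>}"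
      by (intro card_mono) (simp_all add: fI)
    then show "\<nu> \<le> real (card {i\<in>I. v i \<in> ball (z \<beta>) \<delta>})" using cells[OF be] by linarith
  qed
  have "(\<Sum>i\<in>I. (y i $ j - q (x i) $ j)\<^sup>2) \<le> (\<Sum>i\<in>I. (\<xi> i)\<^sup>2)"
    using local_poly_regressor_coordinatewise[OF reg, of j c] by (simp add: I_def \<xi>_def P_def)
  moreover have "(y i $ j - q (x i) $ j)\<^sup>2 = (\<xi> i)\<^sup>2 - 2 * (\<xi> i * (q (x i) $ j - P (x i))) + (q (x i) $ j - P (x i))\<^sup>2" for i
    by (simp add: \<xi>_def power2_eq_square algebra_simps)
  ultimately have "(\<Sum>i\<in>I. (q (x i) $ j - P (x i))\<^sup>2) \<le> 2 * (\<Sum>i\<in>I. \<xi> i * (q (x i) $ j - P (x i)))"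
    by (simp add: sum.distrib sum_subtractf sum_distrib_left)
  then have "(\<Sum>\<alpha>\<in>multi_indices r. \<bar>\<theta> \<alpha>\<bar>) \<le>
        K / \<nu> * (\<Sum>\<alpha>\<in>multi_indices r. \<bar>\<Sum>i\<in>I. \<xi> i * multi_power (v i) \<alpha>\<bar>)"
    using ls[unfolded stabilizes_least_squares_def, rule_format, OF fI nu, of v \<theta> \<xi>] cells' unfolding Delta by blast
  also have "\<dots> \<le> K / \<nu> * (\<Sum>\<alpha>\<in>(multi_indices r :: ('d \<Rightarrow> nat) set). t + e * N)"
  proof (intro mult_left_mono sum_mono)
    fix \<alpha> :: "'d \<Rightarrow> nat" assume al: "\<alpha> \<in> multi_indices r"
    have "(\<Sum>i\<in>I. (y i $ j - g (x i)) * multi_power (v i) \<alpha>) =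
      (\<Sum>i\<in>{1..n}. (y i $ j - g (x i)) * (multi_power ((1/h) *\<^sub>R x i) \<alpha> * indicator (cball 0 h) (x i)))"
      unfolding I_eq v_def by (subst sum.inter_filter) (auto simp: indicator_def intro!: sum.cong)
    then have n1: "\<bar>\<Sum>i\<in>I. (y i $ j - g (x i)) * multi_power (v i) \<alpha>\<bar> \<le> t" using noise[OF al] by simp
    have "\<bar>\<Sum>i\<in>I. (g (x i) - P (x i)) * multi_power (v i) \<alpha>\<bar> \<le> (\<Sum>i\<in>I. e)"
    proof (intro order.trans[OF sum_abs] sum_mono)
      fix i assume "i \<in> I"
      then have xi: "norm (x i) \<le> h" by (simp add: I_eq)
      then have "norm (v i) \<le> 1" using h by (simp add: v_def)
      then have "\<bar>g (x i) - P (x i)\<bar> * \<bar>multi_power (v i) \<alpha>\<bar> \<le> e * 1"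
        using bias[OF xi] e0 by (intro mult_mono abs_multi_power_le_1) (auto simp: P_def)
      then show "\<bar>(g (x i) - P (x i)) * multi_power (v i) \<alpha>\<bar> \<le> e" by (simp add: abs_mult)
    qed
    also have "\<dots> \<le> e * N" using mult_left_mono[OF count e0] by (simp add: I_eq mult.commute)
    finally have n2: "\<bar>\<Sum>i\<in>I. (g (x i) - P (x i)) * multi_power (v i) \<alpha>\<bar> \<le> e * N" .
    have "(\<Sum>i\<in>I. \<xi> i * multi_power (v i) \<alpha>) =
      (\<Sum>i\<in>I. (y i $ j - g (x i)) * multi_power (v i) \<alpha>) + (\<Sum>i\<in>I. (g (x i) - P (x i)) * multi_power (v i) \<alpha>)"
      by (simp add: \<xi>_def sum.distrib[symmetric] algebra_simps)
    then show "\<bar>\<Sum>i\<in>I. \<xi> i * multi_power (v i) \<alpha>\<bar> \<le> t + e * N" using n1 n2 by linarith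
  qed (use K nu in auto)
  finally have "(\<Sum>\<alpha>\<in>multi_indices r. \<bar>b \<alpha> - c \<alpha>\<bar> * h ^ (\<Sum>i\<in>UNIV. \<alpha> i)) \<le>
      K / \<nu> * (real (card (multi_indices r :: ('d \<Rightarrow> nat) set)) * (t + e * N))"
    using h by (simp add: \<theta>_def abs_mult)
  then show ?thesis using b by blast
qed

text \<open>Partial derivatives at the origin are coefficients up to factorials, and a coefficient of order at
  most \<open>m\<close> loses a factor \<open>h\<^sup>m\<close> when the rescaling is undone. If \<open>m\<close> exceeds the degree \<open>r\<close> of the
  regressor, the derivatives of order \<open>m\<close> of the regressor vanish and those of \<open>f\<close> enter as a constant
  error.\<close>

lemma diff_op_coordinate_error:
  fixes q f :: "real^'d::{finite,linorder} \<Rightarrow> real^'D::finite"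
  assumes h: "0 < h" "h \<le> 1" and mr: "m \<le> Suc r"
    and q: "\<forall>u. q u $ j = (\<Sum>\<alpha>\<in>multi_indices r. b \<alpha> * multi_power u \<alpha>)"
    and c: "\<And>\<alpha>. c \<alpha> = multi_partial \<alpha> (\<lambda>u. f u $ j) 0 / multi_fact \<alpha>"
  shows "\<bar>(diff_op m a q 0 - diff_op m a f 0) $ j\<bar> \<le>
    (\<Sum>\<alpha>\<in>multi_indices m. \<bar>a \<alpha>\<bar> * multi_fact \<alpha>) *
      ((\<Sum>\<alpha>\<in>multi_indices r. \<bar>b \<alpha> - c \<alpha>\<bar> * h ^ (\<Sum>i\<in>UNIV. \<alpha> i)) / h ^ m) +
    (if m = Suc r then \<Sum>\<alpha>\<in>multi_indices m. \<bar>a \<alpha> * multi_partial \<alpha> (\<lambda>u. f u $ j) 0\<bar> else 0)"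
proof -
  define E where "E = (\<Sum>\<alpha>\<in>multi_indices r. \<bar>b \<alpha> - c \<alpha>\<bar> * h ^ (\<Sum>i\<in>UNIV. \<alpha> i))"
  define R where "R = (\<lambda>\<alpha>. if m = Suc r then \<bar>a \<alpha> * multi_partial \<alpha> (\<lambda>u. f u $ j) 0\<bar> else 0)"
  have E0: "E \<ge> 0" unfolding E_def using h by (intro sum_nonneg) auto
  have "(\<lambda>u. q u $ j) = (\<lambda>u. \<Sum>\<alpha>\<in>multi_indices r. b \<alpha> * multi_power u \<alpha>)" using q by auto
  then have qp: "multi_partial \<alpha> (\<lambda>u. q u $ j) 0 = (if \<alpha> \<in> multi_indices r then b \<alpha> * multi_fact \<alpha> else 0)" for \<alpha>
    by (simp add: multi_partial_polynomial_at_0)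
  have summand: "\<bar>a \<alpha> * multi_partial \<alpha> (\<lambda>u. q u $ j) 0 - a \<alpha> * multi_partial \<alpha> (\<lambda>u. f u $ j) 0\<bar>
      \<le> \<bar>a \<alpha>\<bar> * multi_fact \<alpha> * (E / h ^ m) + R \<alpha>" if al: "\<alpha> \<in> multi_indices m" for \<alpha>
  proof (cases "\<alpha> \<in> multi_indices r")
    case True
    have "\<bar>b \<alpha> - c \<alpha>\<bar> * h ^ m \<le> \<bar>b \<alpha> - c \<alpha>\<bar> * h ^ (\<Sum>i\<in>UNIV. \<alpha> i)"
      using al h by (intro mult_left_mono power_decreasing) (auto simp: multi_indices_def)
    also have "\<dots> \<le> E" unfolding E_def using True h
      by (intro member_le_sum[of \<alpha> _ "\<lambda>\<alpha>. \<bar>b \<alpha> - c \<alpha>\<bar> * h ^ (\<Sum>i\<in>UNIV. \<alpha> i)"] finite_multi_indices) auto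
    finally have bc: "\<bar>b \<alpha> - c \<alpha>\<bar> \<le> E / h ^ m" using h by (simp add: pos_le_divide_eq)
    have "a \<alpha> * multi_partial \<alpha> (\<lambda>u. q u $ j) 0 - a \<alpha> * multi_partial \<alpha> (\<lambda>u. f u $ j) 0
        = a \<alpha> * multi_fact \<alpha> * (b \<alpha> - c \<alpha>)"
      using True multi_fact_pos[of \<alpha>] unfolding qp c by (simp add: field_simps)
    then have "\<bar>a \<alpha> * multi_partial \<alpha> (\<lambda>u. q u $ j) 0 - a \<alpha> * multi_partial \<alpha> (\<lambda>u. f u $ j) 0\<bar>
        = \<bar>a \<alpha>\<bar> * multi_fact \<alpha> * \<bar>b \<alpha> - c \<alpha>\<bar>"
      using multi_fact_pos[of \<alpha>] by (simp add: abs_mult)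
    also have "\<dots> \<le> \<bar>a \<alpha>\<bar> * multi_fact \<alpha> * (E / h ^ m)"
      using bc multi_fact_pos[of \<alpha>] by (intro mult_left_mono) auto
    finally have "\<bar>a \<alpha> * multi_partial \<alpha> (\<lambda>u. q u $ j) 0 - a \<alpha> * multi_partial \<alpha> (\<lambda>u. f u $ j) 0\<bar>
        \<le> \<bar>a \<alpha>\<bar> * multi_fact \<alpha> * (E / h ^ m)" .
    moreover have "R \<alpha> \<ge> 0" by (simp add: R_def)
    ultimately show ?thesis by linarith
  next
    case False
    then have "m = Suc r" using al mr by (auto simp: multi_indices_def)
    moreover have "0 \<le> \<bar>a \<alpha>\<bar> * multi_fact \<alpha> * (E / h ^ m)"
      using E0 h multi_fact_pos[of \<alpha>] by simp
    ultimately show ?thesis using False by (simp add: qp R_def)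
  qed
  have "\<bar>(diff_op m a q 0 - diff_op m a f 0) $ j\<bar> =
    \<bar>\<Sum>\<alpha>\<in>multi_indices m. a \<alpha> * multi_partial \<alpha> (\<lambda>u. q u $ j) 0 - a \<alpha> * multi_partial \<alpha> (\<lambda>u. f u $ j) 0\<bar>"
    by (simp add: diff_op_def sum_subtractf)
  also have "\<dots> \<le> (\<Sum>\<alpha>\<in>multi_indices m. \<bar>a \<alpha>\<bar> * multi_fact \<alpha> * (E / h ^ m) + R \<alpha>)"
    by (intro order.trans[OF sum_abs] sum_mono summand)
  also have "\<dots> = (\<Sum>\<alpha>\<in>multi_indices m. \<bar>a \<alpha>\<bar> * multi_fact \<alpha>) * (E / h ^ m) + (\<Sum>\<alpha>\<in>multi_indices m. R \<alpha>)"
    by (simp only: sum.distrib sum_distrib_right)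
  also have "(\<Sum>\<alpha>\<in>multi_indices m. R \<alpha>) =
    (if m = Suc r then \<Sum>\<alpha>\<in>multi_indices m. \<bar>a \<alpha> * multi_partial \<alpha> (\<lambda>u. f u $ j) 0\<bar> else 0)"
    by (simp add: R_def)
  finally show ?thesis unfolding E_def .
qed

section \<open>Rate of convergence\<close>

lemma outer_measure_of_le: "A \<subseteq> B \<Longrightarrow> B \<in> sets M \<Longrightarrow> outer_measure_of M A \<le> emeasure M B"
  unfolding outer_measure_of_def by (intro INF_lower) auto

theorem theorem3p1:
  fixes k m :: nat
    and f :: "real^'d::{finite,linorder} \<Rightarrow> real^'D::finite"
    and M :: "'w measure" and X :: "'w \<Rightarrow> real^'d::_" and Y :: "'w \<Rightarrow> real^'D"
    and p :: "real^'d::_ \<Rightarrow> ennreal" and U :: "(real^'d::_) set"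
    and c :: real
    and a :: "('d \<Rightarrow> nat) \<Rightarrow> real"
    and h :: "nat \<Rightarrow> real" and l :: real
    and S :: "nat \<Rightarrow> 's measure"
    and x :: "nat \<Rightarrow> nat \<Rightarrow> 's \<Rightarrow> real^'d::_" and y :: "nat \<Rightarrow> nat \<Rightarrow> 's \<Rightarrow> real^'D"
    and pistar :: "nat \<Rightarrow> 's \<Rightarrow> real^'d::_ \<Rightarrow> real^'D"
  assumes "k \<ge> 1" and "m \<le> k"
    and "C_map k f"
    and "prob_space M" and "Y \<in> borel_measurable M"
    and "distributed M lborel X p"
    and "open U" and "0 \<in> U"
    and "\<exists>A B :: real. A > 0 \<and> (\<forall>u\<in>U. ennreal A \<le> p u \<and> p u \<le> ennreal B)"
    and "cond_second_moment_finite M X Y"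
    and "AE w in M. f (X w) = cond_mean M X Y w"
    and "AE w in M. onorm ((*v) (cond_cov M X Y w)) \<le> sqrt (c / real CARD('D))"
    and "\<And>n. n \<ge> 1 \<Longrightarrow> h n > 0"
    and "(\<lambda>n. real n powr (1 / real (2 * k + CARD('d))) * h n) \<longlonglongrightarrow> l" and "l > 0"
    and "\<And>n. n \<ge> 1 \<Longrightarrow> iid_sample M X Y n (S n) (x n) (y n)"
    and "\<And>n s. n \<ge> 1 \<Longrightarrow> s \<in> space (S n) \<Longrightarrow>
           local_poly_regressor (k - 1) n (h n) (\<lambda>i. x n i s) (\<lambda>i. y n i s) (pistar n s)"
  shows "\<forall>\<epsilon>>0. \<exists>(C::real) N. \<forall>n>N.
           outer_measure_of (S n)
             {s \<in> space (S n).
                norm (diff_op m a (pistar n s) 0 - diff_op m a f 0)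
                  > C / real n powr (real (k - m) / real (2 * k + CARD('d)))}
           \<le> ennreal \<epsilon>"
proof -
  define dd where "dd = CARD('d)"
  define r where "r = k - 1"
  define MI where "MI = (multi_indices r :: ('d \<Rightarrow> nat) set)"
  define \<sigma> where "\<sigma> = sqrt (c / real CARD('D))"
  define sc where "sc = (\<lambda>n::nat. real n powr (1 / real (2 * k + dd)))"
  have kr: "k = Suc r" using assms(1) by (simp add: r_def)
  have finMI: "finite MI" by (simp add: MI_def finite_multi_indices)
  interpret M: prob_space M by fact
  have X: "X \<in> borel_measurable M" using distributed_measurable[OF assms(6)] by simp
  note Y = assms(5)
  have Cf: "C_scalar k (\<lambda>u. f u $ j)" for j using assms(3) by (simp add: C_map_def)
  have f: "continuous_on UNIV f"
    using continuous_on_vec_lambda[of UNIV "\<lambda>j u. f u $ j"] C_scalar_continuous[OF Cf] by simp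

  obtain A B where A: "A > 0" and AB: "\<And>u. u \<in> U \<Longrightarrow> ennreal A \<le> p u \<and> p u \<le> ennreal B"
    using assms(9) by blast
  have "ennreal A \<le> ennreal B" using AB[OF assms(8)] order.trans by blast
  then have Bpos: "B > 0" using A by (metis ennreal_le_iff2 less_le_not_le linorder_le_cases order_less_le_trans)
  obtain eU where eU: "eU > 0" "cball 0 eU \<subseteq> U" using assms(7,8) open_contains_cball by blast

  obtain G :: "('d \<Rightarrow> nat) set" and z :: "('d \<Rightarrow> nat) \<Rightarrow> real^'d::_" and \<delta> K where
    G: "finite G" "\<forall>\<beta>\<in>G. norm (z \<beta>) \<le> 1/2" "0 < \<delta>" "\<delta> \<le> 1/2" "0 \<le> K" and
    ls: "stabilizes_least_squares r G z \<delta> K"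
    using occupied_cells_control_least_squares[of r, where 'd='d]
    by (elim exE conjE) (rule that, assumption+)

  define tc where "tc = (\<lambda>j \<alpha>. multi_partial \<alpha> (\<lambda>u. f u $ j) 0 / multi_fact \<alpha>)"
  have "\<exists>T. \<forall>j. 0 \<le> T j \<and> (\<forall>u. norm u \<le> 1 \<longrightarrow>
      \<bar>f u $ j - (\<Sum>\<alpha>\<in>MI. tc j \<alpha> * multi_power u \<alpha>)\<bar> \<le> T j * norm u ^ k)"
    using multivariate_Taylor[OF Cf assms(1)] unfolding MI_def r_def tc_def by (intro choice) blast
  then obtain T where T0: "\<And>j. T j \<ge> 0" and
    T: "\<And>j u. norm u \<le> 1 \<Longrightarrow> \<bar>f u $ j - (\<Sum>\<alpha>\<in>MI. tc j \<alpha> * multi_power u \<alpha>)\<bar> \<le> T j * norm u ^ k"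
    by blast

  \<comment> \<open>The natural unit is s = n powr (1/(2k+d)): then n = s^(2k+d) and the bandwidth
    lies between l/(2s) and 2l/s, so that the expected number of points in a ball of radius
    proportional to the bandwidth is of order s^(2k). The constant V bounds that of the whole ball
    from above, and half of that of each cell is at least \<nu>0 * s^(2k).\<close>
  define V where "V = B * unit_ball_vol (real dd) * (2 * l) ^ dd"
  define \<nu>0 where "\<nu>0 = A * unit_ball_vol (real dd) * (\<delta> * (l / 2)) ^ dd / 2"
  have ubv: "unit_ball_vol (real dd) > 0" by simp
  have Vpos: "V > 0" and nupos: "\<nu>0 > 0"
    using A Bpos \<open>l > 0\<close> G(3) ubv by (simp_all add: V_def \<nu>0_def)
  have sc_pos: "sc n > 0" if "n \<ge> 1" for n using that by (simp add: sc_def)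
  have sc_pow: "real n = sc n ^ (2 * k) * sc n ^ dd" if "n \<ge> 1" for n
  proof -
    have "sc n ^ (2 * k + dd) = real n powr (1 / real (2 * k + dd) * real (2 * k + dd))"
      using that by (simp add: sc_def powr_power)
    also have "1 / real (2 * k + dd) * real (2 * k + dd) = 1" using assms(1) by simp
    also have "real n powr 1 = real n" using that by simp
    finally show ?thesis by (simp add: power_add)
  qed
  have sc_top: "filterlim sc at_top sequentially"
    unfolding filterlim_at_top
  proof
    fix W :: real
    obtain n0 :: nat where n0: "\<bar>W\<bar> ^ (2 * k + dd) \<le> real n0" using real_arch_simple by blast
    show "\<forall>\<^sub>F n in sequentially. W \<le> sc n"
      using eventually_ge_at_top[of "max 1 n0"]
    proof eventually_elim
      case (elim n)
      then have "\<bar>W\<bar> ^ (2 * k + dd) \<le> sc n ^ (2 * k + dd)"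
        using n0 sc_pow[of n] by (simp add: power_add)
      then have "\<bar>W\<bar> \<le> sc n"
        using assms(1) sc_pos[of n] elim by (subst (asm) power_mono_iff) auto
      then show ?case by simp
    qed
  qed
  have scpow_top: "filterlim (\<lambda>n. sc n ^ (2 * k)) at_top sequentially"
    using sc_top assms(1) by (intro filterlim_pow_at_top) auto
  have lim: "(\<lambda>n. sc n * h n) \<longlonglongrightarrow> l" using assms(14) by (simp add: sc_def dd_def)
  have ev_l: "\<forall>\<^sub>F n in sequentially. l / 2 < sc n * h n \<and> sc n * h n < 2 * l"
    using order_tendstoD(1)[OF lim, of "l / 2"] order_tendstoD(2)[OF lim, of "2 * l"] \<open>l > 0\<close>
    by (intro eventually_conj) auto
  have hlim: "h \<longlonglongrightarrow> 0"
  proof (rule Lim_transform_eventually)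
    show "(\<lambda>n. (sc n * h n) * inverse (sc n)) \<longlonglongrightarrow> 0"
      using tendsto_mult[OF lim tendsto_inverse_0_at_top[OF sc_top]] by simp
    show "\<forall>\<^sub>F n in sequentially. sc n * h n * inverse (sc n) = h n"
      using eventually_ge_at_top[of 1]
    proof eventually_elim
      case (elim n)
      then show ?case using sc_pos[of n] by simp
    qed
  qed
  have ev_h: "\<forall>\<^sub>F n in sequentially. h n < min 1 eU"
    using order_tendstoD(2)[OF hlim, of "min 1 eU"] eU by auto

  show ?thesis
  proof (intro allI impI)
    fix \<epsilon> :: real assume eps: "\<epsilon> > 0"
    \<comment> \<open>The noise events have total probability at most \<open>L /
      \<tau>\<^sup>2\<close>, which the choice of \<tau> makes at most half of \<epsilon>; the
      counting events have total probability at most Q / s^(2k), which is made small by taking n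
      large.\<close>
    define L where "L = real CARD('D) * real (card MI) * \<bar>\<sigma>\<bar> * V"
    define \<tau> where "\<tau> = sqrt (2 * (L + 1) / \<epsilon>)"
    have L0: "L \<ge> 0" using Vpos by (simp add: L_def)
    have tau: "\<tau> > 0" "\<tau>\<^sup>2 = 2 * (L + 1) / \<epsilon>" using L0 eps by (simp_all add: \<tau>_def)
    have Ltau: "L / \<tau>\<^sup>2 \<le> \<epsilon> / 2" using L0 eps unfolding tau(2) by (simp add: field_simps)
    define Q where "Q = real (card G) * 2 / \<nu>0 + 1 / V"
    have Q0: "Q > 0" using Vpos nupos by (simp add: Q_def add_nonneg_pos)
    \<comment> \<open>C1 j / s^k bounds the rescaled coefficient error of the coordinate j, with a
      noise part and a bias part; A1 is the cost of applying the operator, and A2 the constant error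
      in the case m = k, where the rate is constant too.\<close>
    define C1 where "C1 = (\<lambda>j. K * real (card MI) * (\<tau> + T j * (2 * l) ^ k * (2 * V)) / \<nu>0)"
    define A1 where "A1 = (\<Sum>\<alpha>\<in>multi_indices m. \<bar>a \<alpha>\<bar> * multi_fact \<alpha>)"
    define A2 where "A2 = (\<lambda>j. \<Sum>\<alpha>\<in>multi_indices m. \<bar>a \<alpha> * multi_partial \<alpha> (\<lambda>u. f u $ j) 0\<bar>)"
    define C where "C = (\<Sum>j\<in>UNIV. A1 * C1 j / (l / 2) ^ m + A2 j)"
    have "\<forall>\<^sub>F n in sequentially. 2 * Q / \<epsilon> \<le> sc n ^ (2 * k)"
      using scpow_top by (simp add: filterlim_at_top)
    with ev_l ev_h eventually_ge_at_top[of 1]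
    have "\<forall>\<^sub>F n in sequentially. (l / 2 < sc n * h n \<and> sc n * h n < 2 * l) \<and> h n < min 1 eU \<and>
       1 \<le> n \<and> 2 * Q / \<epsilon> \<le> sc n ^ (2 * k)"
      by eventually_elim blast
    then obtain N where N: "\<And>n. n \<ge> N \<Longrightarrow> (l / 2 < sc n * h n \<and> sc n * h n < 2 * l) \<and> h n < min 1 eU \<and>
       1 \<le> n \<and> 2 * Q / \<epsilon> \<le> sc n ^ (2 * k)"
      unfolding eventually_sequentially by blast
    show "\<exists>(C::real) N. \<forall>n>N.
           outer_measure_of (S n)
             {s \<in> space (S n).
                norm (diff_op m a (pistar n s) 0 - diff_op m a f 0)
                  > C / real n powr (real (k - m) / real (2 * k + CARD('d)))}
           \<le> ennreal \<epsilon>"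
    proof (intro exI[of _ C] exI[of _ N] allI impI)
      fix n assume nN: "n > N"
      define s where "s = sc n"
      define \<eta> where "\<eta> = h n"
      have n1: "n \<ge> 1" and lo: "l / 2 < s * \<eta>" and hi: "s * \<eta> < 2 * l" and
        h1: "\<eta> \<le> 1" and hU: "\<eta> \<le> eU" and big: "2 * Q / \<epsilon> \<le> s ^ (2 * k)"
        using N[of n] nN by (auto simp: s_def \<eta>_def)
      have h0: "\<eta> > 0" using assms(13)[OF n1] by (simp add: \<eta>_def)
      have s0: "s > 0" using sc_pos[OF n1] by (simp add: s_def)
      have ns: "real n = s ^ (2 * k) * s ^ dd" using sc_pow[OF n1] by (simp add: s_def)
      have iid: "iid_sample M X Y n (S n) (x n) (y n)" by (rule assms(16)[OF n1])
      interpret S: prob_space "S n" using iid by (simp add: iid_sample_def)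
      have s2k: "s ^ (2 * k) > 0" using s0 by simp

      define q where "q D = measure M (X -` D \<inter> space M)" for D
      have mball: "measure lborel (ball (\<eta> *\<^sub>R z \<beta>) (\<eta> * \<delta>)) = unit_ball_vol (real dd) * (\<eta> * \<delta>) ^ dd" for \<beta>
        using h0 G(3) by (simp add: content_ball dd_def)
      have mcball: "measure lborel (cball (0::real^'d::_) \<eta>) = unit_ball_vol (real dd) * \<eta> ^ dd"
        using h0 by (simp add: content_cball dd_def)
      have sub: "ball (\<eta> *\<^sub>R z \<beta>) (\<eta> * \<delta>) \<subseteq> U" if "\<beta> \<in> G" for \<beta>
      proof
        fix u assume u: "u \<in> ball (\<eta> *\<^sub>R z \<beta>) (\<eta> * \<delta>)"
        have "norm u \<le> norm (\<eta> *\<^sub>R z \<beta>) + dist (\<eta> *\<^sub>R z \<beta>) u" by (metis dist_0_norm dist_triangle)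
        also have "\<dots> \<le> \<eta> * (1/2) + \<eta> * (1/2)"
        proof (rule add_mono)
          show "norm (\<eta> *\<^sub>R z \<beta>) \<le> \<eta> * (1/2)"
            using mult_left_mono[of "norm (z \<beta>)" "1/2" \<eta>] G(2) h0 that by simp
          show "dist (\<eta> *\<^sub>R z \<beta>) u \<le> \<eta> * (1/2)"
            using u mult_left_mono[OF G(4) less_imp_le[OF h0]] unfolding mem_ball by linarith
        qed
        finally show "u \<in> U" using hU eU(2) by auto
      qed
      have qlow: "2 * (\<nu>0 * s ^ (2 * k)) \<le> real n * q (ball (\<eta> *\<^sub>R z \<beta>) (\<eta> * \<delta>))" if be: "\<beta> \<in> G" for \<beta>
      proof -
        have "A * (unit_ball_vol (real dd) * (\<eta> * \<delta>) ^ dd) \<le> q (ball (\<eta> *\<^sub>R z \<beta>) (\<eta> * \<delta>))"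
          unfolding q_def mball[of \<beta>, symmetric]
          by (rule distributed_measure_bounds(1)[OF assms(4,6) AB A])
             (use sub[OF be] mult_pos_pos[OF h0 G(3)] in \<open>auto simp: not_le intro: emeasure_bounded_finite[unfolded infinity_ennreal_def]\<close>)
        then have "real n * (A * (unit_ball_vol (real dd) * (\<eta> * \<delta>) ^ dd)) \<le> real n * q (ball (\<eta> *\<^sub>R z \<beta>) (\<eta> * \<delta>))"
          by (intro mult_left_mono) auto
        moreover have "real n * (A * (unit_ball_vol (real dd) * (\<eta> * \<delta>) ^ dd)) =
            A * unit_ball_vol (real dd) * (\<delta> * (s * \<eta>)) ^ dd * s ^ (2 * k)"
          by (simp add: ns power_mult_distrib)
        moreover have "A * unit_ball_vol (real dd) * (\<delta> * (l / 2)) ^ dd * s ^ (2 * k) \<le>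
            A * unit_ball_vol (real dd) * (\<delta> * (s * \<eta>)) ^ dd * s ^ (2 * k)"
          using lo A ubv G(3) \<open>l > 0\<close> s0 by (intro mult_right_mono mult_left_mono power_mono) auto
        ultimately show ?thesis by (simp add: \<nu>0_def)
      qed
      have qhigh: "real n * q (cball 0 \<eta>) \<le> V * s ^ (2 * k)"
      proof -
        have "q (cball 0 \<eta>) \<le> B * (unit_ball_vol (real dd) * \<eta> ^ dd)"
          unfolding q_def mcball[symmetric]
          by (rule distributed_measure_bounds(2)[OF assms(4,6) AB A])
             (use hU eU(2) h0 in \<open>auto intro: emeasure_bounded_finite[unfolded infinity_ennreal_def]\<close>)
        then have "real n * q (cball 0 \<eta>) \<le> real n * (B * (unit_ball_vol (real dd) * \<eta> ^ dd))"
          by (intro mult_left_mono) auto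
        also have "\<dots> = B * unit_ball_vol (real dd) * (s * \<eta>) ^ dd * s ^ (2 * k)"
          by (simp add: ns power_mult_distrib)
        also have "\<dots> \<le> B * unit_ball_vol (real dd) * (2 * l) ^ dd * s ^ (2 * k)"
          using hi Bpos ubv h0 s0 by (intro mult_right_mono mult_left_mono power_mono) auto
        finally show ?thesis by (simp add: V_def)
      qed

      \<comment> \<open>The three ways to fail: a cell with too few points, a ball with too many points, and noise
        that correlates too much with a monomial.\<close>
      define E1 where "E1 = (\<lambda>\<beta>. {\<omega>\<in>space (S n). real n * q (ball (\<eta> *\<^sub>R z \<beta>) (\<eta> * \<delta>)) / 2 \<le>
        \<bar>real (card {i\<in>{1..n}. x n i \<omega> \<in> ball (\<eta> *\<^sub>R z \<beta>) (\<eta> * \<delta>)}) - real n * q (ball (\<eta> *\<^sub>R z \<beta>) (\<eta> * \<delta>))\<bar>})"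
      define E2 where "E2 = {\<omega>\<in>space (S n). V * s ^ (2 * k) \<le>
        \<bar>real (card {i\<in>{1..n}. x n i \<omega> \<in> cball 0 \<eta>}) - real n * q (cball 0 \<eta>)\<bar>}"
      define w :: "('d \<Rightarrow> nat) \<Rightarrow> real^'d::_ \<Rightarrow> real"
        where "w = (\<lambda>\<alpha> u. multi_power ((1/\<eta>) *\<^sub>R u) \<alpha> * indicator (cball 0 \<eta>) u)"
      define E3 where "E3 = (\<lambda>j \<alpha>. {\<omega>\<in>space (S n). \<tau> * s ^ k \<le>
        \<bar>\<Sum>i\<in>{1..n}. (y n i \<omega> $ j - f (x n i \<omega>) $ j) * w \<alpha> (x n i \<omega>)\<bar>})"
      have E1: "E1 \<beta> \<in> sets (S n)" "measure (S n) (E1 \<beta>) \<le> 2 / \<nu>0 / s ^ (2 * k)" if "\<beta> \<in> G" for \<beta>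
      proof -
        define Dq where "Dq = q (ball (\<eta> *\<^sub>R z \<beta>) (\<eta> * \<delta>))"
        have nq: "2 * (\<nu>0 * s ^ (2 * k)) \<le> real n * Dq" using qlow[OF that] by (simp add: Dq_def)
        have nq0: "real n * Dq > 0" using nq nupos s2k by (smt (verit) mult_pos_pos)
        then have half: "real n * Dq / 2 > 0" by simp
        have bs: "ball (\<eta> *\<^sub>R z \<beta>) (\<eta> * \<delta>) \<in> sets borel" by simp
        note cc = count_Chebyshev[OF assms(4) X Y iid bs half, folded q_def, folded Dq_def]
        have E1eq: "E1 \<beta> = {\<omega>\<in>space (S n). real n * Dq / 2 \<le>
            \<bar>real (card {i\<in>{1..n}. x n i \<omega> \<in> ball (\<eta> *\<^sub>R z \<beta>) (\<eta> * \<delta>)}) - real n * Dq\<bar>}"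
          by (simp only: E1_def Dq_def)
        show "E1 \<beta> \<in> sets (S n)" unfolding E1eq by (rule cc(1))
        have "measure (S n) (E1 \<beta>) \<le> real n * Dq / (real n * Dq / 2)\<^sup>2"
          unfolding E1eq by (rule cc(2))
        also have "\<dots> = 4 / (real n * Dq)" by (simp add: power2_eq_square)
        also have "\<dots> \<le> 4 / (2 * (\<nu>0 * s ^ (2 * k)))"
          using nq nupos s2k by (intro frac_le) simp_all
        finally show "measure (S n) (E1 \<beta>) \<le> 2 / \<nu>0 / s ^ (2 * k)" by simp
      qed
      have E2: "E2 \<in> sets (S n)" "measure (S n) E2 \<le> 1 / V / s ^ (2 * k)"
      proof -
        have Vs: "V * s ^ (2 * k) > 0" using Vpos s2k by simp
        have bs: "cball (0 :: real^'d::_) \<eta> \<in> sets borel" by simp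
        note cc = count_Chebyshev[OF assms(4) X Y iid bs Vs, folded q_def, folded E2_def]
        show "E2 \<in> sets (S n)" by (rule cc(1))
        have "measure (S n) E2 \<le> real n * q (cball 0 \<eta>) / (V * s ^ (2 * k))\<^sup>2"
          by (rule cc(2))
        also have "\<dots> \<le> V * s ^ (2 * k) / (V * s ^ (2 * k))\<^sup>2"
          using qhigh by (intro divide_right_mono) auto
        also have "\<dots> = 1 / V / s ^ (2 * k)" using Vs by (simp add: power2_eq_square)
        finally show "measure (S n) E2 \<le> 1 / V / s ^ (2 * k)" .
      qed
      have E3: "E3 j \<alpha> \<in> sets (S n)" "measure (S n) (E3 j \<alpha>) \<le> \<bar>\<sigma>\<bar> * V / \<tau>\<^sup>2" for j \<alpha>
      proof -
        have ts: "\<tau> * s ^ k > 0" using tau s0 by simp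
        have mpc: "continuous_on UNIV (\<lambda>u::(real^'d::_). multi_power ((1/\<eta>) *\<^sub>R u) \<alpha>)"
          unfolding multi_power_def by (intro continuous_intros)
        have wm: "w \<alpha> \<in> borel_measurable borel"
          unfolding w_def by (intro borel_measurable_times borel_measurable_continuous_onI[OF mpc] borel_measurable_indicator) simp
        have wb: "\<bar>w \<alpha> u\<bar> \<le> indicator (cball 0 \<eta>) u" for u
          using abs_multi_power_le_1[of "(1/\<eta>) *\<^sub>R u" \<alpha>] h0 by (auto simp: w_def indicator_def)
        note nc = noise_Chebyshev[OF assms(4) X Y iid ts assms(10,11) assms(12)[folded \<sigma>_def] f wm wb, of j]
        show "E3 j \<alpha> \<in> sets (S n)" unfolding E3_def by (rule nc(1))
        have "measure (S n) (E3 j \<alpha>) \<le> real n * (\<sigma> * q (cball 0 \<eta>)) / (\<tau> * s ^ k)\<^sup>2"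
          unfolding E3_def q_def by (rule nc(2))
        also have "\<dots> = \<sigma> * (real n * q (cball 0 \<eta>)) / (\<tau> * s ^ k)\<^sup>2" by simp
        also have "\<dots> \<le> \<bar>\<sigma>\<bar> * (V * s ^ (2 * k)) / (\<tau> * s ^ k)\<^sup>2"
          by (rule divide_right_mono[OF mult_mono[OF abs_ge_self qhigh]]) (simp_all add: q_def)
        also have "\<dots> = \<bar>\<sigma>\<bar> * V / \<tau>\<^sup>2"
          using s0 by (simp add: power_mult_distrib power_even_eq)
        finally show "measure (S n) (E3 j \<alpha>) \<le> \<bar>\<sigma>\<bar> * V / \<tau>\<^sup>2" .
      qed
      define Bad where "Bad = (\<Union>\<beta>\<in>G. E1 \<beta>) \<union> (E2 \<union> (\<Union>j\<in>UNIV. \<Union>\<alpha>\<in>MI. E3 j \<alpha>))"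
      have Bad_sets: "Bad \<in> sets (S n)"
        unfolding Bad_def using E1(1) E2(1) E3(1) G(1) finMI
        by (intro sets.Un sets.finite_UN) auto
      have Bad_prob: "measure (S n) Bad \<le> \<epsilon>"
      proof -
        have b1: "measure (S n) (\<Union>\<beta>\<in>G. E1 \<beta>) \<le> real (card G) * (2 / \<nu>0 / s ^ (2 * k))"
        proof -
          have "measure (S n) (\<Union>\<beta>\<in>G. E1 \<beta>) \<le> (\<Sum>\<beta>\<in>G. measure (S n) (E1 \<beta>))"
            using E1(1) G(1) by (intro S.finite_measure_subadditive_finite) auto
          also have "\<dots> \<le> (\<Sum>\<beta>\<in>G. 2 / \<nu>0 / s ^ (2 * k))" by (intro sum_mono E1(2))
          finally show ?thesis by simp
        qed
        have b3: "measure (S n) (\<Union>j\<in>UNIV. \<Union>\<alpha>\<in>MI. E3 j \<alpha>) \<le> L / \<tau>\<^sup>2"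
        proof -
          have "measure (S n) (\<Union>j\<in>UNIV. \<Union>\<alpha>\<in>MI. E3 j \<alpha>) \<le> (\<Sum>j\<in>UNIV. measure (S n) (\<Union>\<alpha>\<in>MI. E3 j \<alpha>))"
            using E3(1) finMI by (intro S.finite_measure_subadditive_finite) (auto intro!: sets.finite_UN)
          also have "\<dots> \<le> (\<Sum>j\<in>(UNIV::'D set). \<Sum>\<alpha>\<in>MI. measure (S n) (E3 j \<alpha>))"
            using E3(1) finMI by (intro sum_mono S.finite_measure_subadditive_finite) auto
          also have "\<dots> \<le> (\<Sum>j\<in>(UNIV::'D set). \<Sum>\<alpha>\<in>MI. \<bar>\<sigma>\<bar> * V / \<tau>\<^sup>2)" by (intro sum_mono E3(2))
          finally show ?thesis by (simp add: L_def)
        qed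
        have "measure (S n) Bad \<le> measure (S n) (\<Union>\<beta>\<in>G. E1 \<beta>) + measure (S n) (E2 \<union> (\<Union>j\<in>UNIV. \<Union>\<alpha>\<in>MI. E3 j \<alpha>))"
          unfolding Bad_def using E1(1) E2(1) E3(1) G(1) finMI
          by (intro measure_Un_le sets.Un sets.finite_UN) auto
        also have "measure (S n) (E2 \<union> (\<Union>j\<in>UNIV. \<Union>\<alpha>\<in>MI. E3 j \<alpha>)) \<le>
            measure (S n) E2 + measure (S n) (\<Union>j\<in>UNIV. \<Union>\<alpha>\<in>MI. E3 j \<alpha>)"
          using E2(1) E3(1) finMI
          by (intro measure_Un_le sets.finite_UN) auto
        finally have "measure (S n) Bad \<le> Q / s ^ (2 * k) + L / \<tau>\<^sup>2"
          using b1 E2(2) b3 by (simp add: Q_def add_divide_distrib)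
        moreover have "Q / s ^ (2 * k) \<le> \<epsilon> / 2"
          using big eps s2k Q0 by (simp add: field_simps)
        ultimately show ?thesis using Ltau by linarith
      qed
      have good: "norm (diff_op m a (pistar n \<omega>) 0 - diff_op m a f 0) \<le>
          C / real n powr (real (k - m) / real (2 * k + CARD('d)))"
        if om: "\<omega> \<in> space (S n)" "\<omega> \<notin> Bad" for \<omega>
      proof -
        have cells: "\<nu>0 * s ^ (2 * k) \<le> real (card {i\<in>{1..n}. x n i \<omega> \<in> ball (\<eta> *\<^sub>R z \<beta>) (\<eta> * \<delta>)})"
          if be: "\<beta> \<in> G" for \<beta>
        proof -
          have "\<omega> \<notin> E1 \<beta>" using om be by (auto simp: Bad_def)
          then have "\<not> real n * q (ball (\<eta> *\<^sub>R z \<beta>) (\<eta> * \<delta>)) / 2 \<le>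
            \<bar>real (card {i\<in>{1..n}. x n i \<omega> \<in> ball (\<eta> *\<^sub>R z \<beta>) (\<eta> * \<delta>)}) - real n * q (ball (\<eta> *\<^sub>R z \<beta>) (\<eta> * \<delta>))\<bar>"
            using om(1) unfolding E1_def by blast
          then show ?thesis using qlow[OF be] by linarith
        qed
        have count: "real (card {i\<in>{1..n}. x n i \<omega> \<in> cball 0 \<eta>}) \<le> 2 * V * s ^ (2 * k)"
        proof -
          have "\<omega> \<notin> E2" using om by (auto simp: Bad_def)
          then have "\<not> V * s ^ (2 * k) \<le>
            \<bar>real (card {i\<in>{1..n}. x n i \<omega> \<in> cball 0 \<eta>}) - real n * q (cball 0 \<eta>)\<bar>"
            using om(1) unfolding E2_def by blast
          then show ?thesis using qhigh by linarith
        qed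
        have coord: "\<bar>(diff_op m a (pistar n \<omega>) 0 - diff_op m a f 0) $ j\<bar> \<le>
            (A1 * C1 j / (l / 2) ^ m + A2 j) / s ^ (k - m)" for j
        proof -
          have noise: "\<bar>\<Sum>i\<in>{1..n}. (y n i \<omega> $ j - f (x n i \<omega>) $ j) *
              (multi_power ((1/\<eta>) *\<^sub>R x n i \<omega>) \<alpha> * indicator (cball 0 \<eta>) (x n i \<omega>))\<bar> \<le> \<tau> * s ^ k"
            if "\<alpha> \<in> multi_indices r" for \<alpha>
          proof -
            have "\<omega> \<notin> E3 j \<alpha>" using om that by (auto simp: Bad_def MI_def)
            then show ?thesis using om(1) unfolding E3_def w_def by force
          qed
          have bias: "\<bar>f u $ j - (\<Sum>\<alpha>\<in>multi_indices r. tc j \<alpha> * multi_power u \<alpha>)\<bar> \<le> T j * \<eta> ^ k"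
            if "norm u \<le> \<eta>" for u
          proof -
            have "T j * norm u ^ k \<le> T j * \<eta> ^ k" using that T0 by (intro mult_left_mono power_mono) auto
            then show ?thesis using T[of u j] that h1 by (simp add: MI_def)
          qed
          have "0 < \<nu>0 * s ^ (2 * k)" using nupos s2k by simp
          from regressor_coefficient_bound[OF h0 this assms(17)[OF n1 om(1), folded r_def \<eta>_def] G(2,4,5) ls
              cells count noise bias]
          obtain b where b: "\<forall>u. pistar n \<omega> u $ j = (\<Sum>\<alpha>\<in>multi_indices r. b \<alpha> * multi_power u \<alpha>)" and
            bc: "(\<Sum>\<alpha>\<in>multi_indices r. \<bar>b \<alpha> - tc j \<alpha>\<bar> * \<eta> ^ (\<Sum>i\<in>UNIV. \<alpha> i)) \<le>
              K / (\<nu>0 * s ^ (2 * k)) * (real (card MI) * (\<tau> * s ^ k + T j * \<eta> ^ k * (2 * V * s ^ (2 * k))))"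
            unfolding MI_def by blast
          have "K / (\<nu>0 * s ^ (2 * k)) * (real (card MI) * (\<tau> * s ^ k + T j * \<eta> ^ k * (2 * V * s ^ (2 * k)))) =
              K * real (card MI) / \<nu>0 * ((\<tau> + T j * (s * \<eta>) ^ k * (2 * V)) / s ^ k)"
          proof -
            have "s ^ (2 * k) = s ^ k * s ^ k" by (simp add: mult_2 power_add)
            then show ?thesis using s0 nupos by (simp add: power_mult_distrib field_simps)
          qed
          also have "\<dots> \<le> K * real (card MI) / \<nu>0 * ((\<tau> + T j * (2 * l) ^ k * (2 * V)) / s ^ k)"
            using G(5) nupos T0[of j] hi s0 h0 Vpos
            by (intro mult_left_mono divide_right_mono add_left_mono mult_right_mono power_mono) auto
          also have "\<dots> = C1 j / s ^ k" by (simp add: C1_def)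
          finally have S1: "(\<Sum>\<alpha>\<in>multi_indices r. \<bar>b \<alpha> - tc j \<alpha>\<bar> * \<eta> ^ (\<Sum>i\<in>UNIV. \<alpha> i)) \<le> C1 j / s ^ k"
            using bc by linarith
          have C10: "C1 j \<ge> 0" unfolding C1_def using G(5) tau T0[of j] \<open>l > 0\<close> Vpos nupos by simp
          have A10: "A1 \<ge> 0" unfolding A1_def by (intro sum_nonneg) (simp add: multi_fact_pos less_imp_le)
          have A20: "A2 j \<ge> 0" unfolding A2_def by (intro sum_nonneg) simp
          have "\<bar>(diff_op m a (pistar n \<omega>) 0 - diff_op m a f 0) $ j\<bar> \<le>
              A1 * ((\<Sum>\<alpha>\<in>multi_indices r. \<bar>b \<alpha> - tc j \<alpha>\<bar> * \<eta> ^ (\<Sum>i\<in>UNIV. \<alpha> i)) / \<eta> ^ m) +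
              (if m = Suc r then A2 j else 0)"
            unfolding A1_def A2_def
            by (rule diff_op_coordinate_error[OF h0 h1 _ b]) (use assms(2) kr in \<open>auto simp: tc_def\<close>)
          also have "\<dots> \<le> A1 * (C1 j / (l / 2) ^ m / s ^ (k - m)) + A2 j / s ^ (k - m)"
          proof (rule add_mono)
            have "(\<Sum>\<alpha>\<in>multi_indices r. \<bar>b \<alpha> - tc j \<alpha>\<bar> * \<eta> ^ (\<Sum>i\<in>UNIV. \<alpha> i)) / \<eta> ^ m \<le> (C1 j / s ^ k) / \<eta> ^ m"
              using S1 h0 by (intro divide_right_mono) auto
            also have "\<dots> = C1 j / (s * \<eta>) ^ m / s ^ (k - m)"
            proof -
              have "s ^ k = s ^ m * s ^ (k - m)" using assms(2) by (simp flip: power_add)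
              then show ?thesis by (simp add: power_mult_distrib mult_ac)
            qed
            also have "\<dots> \<le> C1 j / (l / 2) ^ m / s ^ (k - m)"
              using C10 lo \<open>l > 0\<close> s0 h0
              by (intro divide_right_mono divide_left_mono power_mono mult_pos_pos zero_less_power) auto
            finally show "A1 * ((\<Sum>\<alpha>\<in>multi_indices r. \<bar>b \<alpha> - tc j \<alpha>\<bar> * \<eta> ^ (\<Sum>i\<in>UNIV. \<alpha> i)) / \<eta> ^ m) \<le>
                A1 * (C1 j / (l / 2) ^ m / s ^ (k - m))"
              using A10 by (intro mult_left_mono)
            show "(if m = Suc r then A2 j else 0) \<le> A2 j / s ^ (k - m)"
              using A20 s0 kr by auto
          qed
          finally show ?thesis by (simp add: add_divide_distrib)
        qed
        have "norm (diff_op m a (pistar n \<omega>) 0 - diff_op m a f 0) \<le>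
            (\<Sum>j\<in>UNIV. \<bar>(diff_op m a (pistar n \<omega>) 0 - diff_op m a f 0) $ j\<bar>)"
          by (rule norm_le_l1_cart)
        also have "\<dots> \<le> (\<Sum>j\<in>UNIV. (A1 * C1 j / (l / 2) ^ m + A2 j) / s ^ (k - m))"
          by (intro sum_mono coord)
        also have "\<dots> = C / s ^ (k - m)" by (simp add: C_def sum_divide_distrib)
        also have "s ^ (k - m) = real n powr (real (k - m) / real (2 * k + CARD('d)))"
          using n1 by (simp add: s_def sc_def dd_def powr_power)
        finally show ?thesis .
      qed
      have "outer_measure_of (S n)
             {s \<in> space (S n).
                norm (diff_op m a (pistar n s) 0 - diff_op m a f 0)
                  > C / real n powr (real (k - m) / real (2 * k + CARD('d)))} \<le> emeasure (S n) Bad"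
        using good by (intro outer_measure_of_le Bad_sets) force
      also have "\<dots> \<le> ennreal \<epsilon>"
        using Bad_prob by (simp add: S.emeasure_eq_measure ennreal_leI)
      finally show "outer_measure_of (S n)
             {s \<in> space (S n).
                norm (diff_op m a (pistar n s) 0 - diff_op m a f 0)
                  > C / real n powr (real (k - m) / real (2 * k + CARD('d)))} \<le> ennreal \<epsilon>" .
    qed
  qed
qed

end
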